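(* Let $\mathcal S=\{\phi_i, 1\le i\le m\}$ be a system of injective conformal contractions on a compact set with non-empty interior $V\subset\mathbb R^D$, $D\ge1$, with limit set $\Lambda$. Assume there exist an integer $q\ge1$ and a non-empty open set $W\subset V$ with $\phi_i(W)\subset W$ for $1\le i\le m$, such that the collection of all cylinders $[i_1\ldots i_q]\subset\Sigma_m^+$ of length $q$ can be partitioned into $s$ subcollections $G_1,\ldots,G_s$ with the property that, whenever $[j_1\ldots j_q]\in G_i$ and $[j_1'\ldots j_q']\in G_j$ with $i\ne j$, $1\le i,j\le s$, $$\phi_{j_1\ldots j_q}(W)\cap\phi_{j_1'\ldots j_q'}(W)=\emptyset.$$ Let $m_i:=\mathrm{Card}\,G_i$ for $1\le i\le s$. Let $\mu_{\mathbf p}$ be an arbitrary Bernoulli measure on $\Sigma_m^+$, given by a probability vector $\mathbf p=(p_1,\ldots,p_m)$, and let $\nu_{\mathbf p}=\pi_*\mu_{\mathbf p}$ be the associated self-conformal measure on $\Lambda$. Then $$HD(\nu_{\mathbf p})\ge\frac{-\sum_{1\le i\le m}p_i\log p_i-\frac1q\sum_{1\le i\le s}\log m_i\cdot\sum_{[j_1\ldots j_q]\in G_i}p_{j_1}\cdots p_{j_q}}{|\chi(\mu_{\mathbf p})|}.$$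
   Context: Iterated function system: $\mathcal S=\{\phi_i:V\to V, 1\le i\le m\}$ consists of smooth injective conformal contractions of the compact set $V$; $|\phi_i'(x)|$ denotes the norm of the derivative at $x$. Write $\phi_{i_1\ldots i_p}:=\phi_{i_1}\circ\cdots\circ\phi_{i_p}$. Symbolic space: $\Sigma_m^+$ is the space of one-sided sequences $\omega=(\omega_1,\omega_2,\ldots)$ with entries in $\{1,\ldots,m\}$; $\sigma(\omega)=(\omega_2,\omega_3,\ldots)$; $[i_1\ldots i_q]=\{\omega:\omega_1=i_1,\ldots,\omega_q=i_q\}$. The coding map $\pi:\Sigma_m^+\to\Lambda$ sends $\omega$ to the unique point of $\bigcap_n\phi_{\omega_1\ldots\omega_n}(V)$, and $\Lambda=\pi(\Sigma_m^+)$ is the limit set. Bernoulli measure: $\mu_{\mathbf p}([i_1\ldots i_n])=p_{i_1}\cdots p_{i_n}$ for every cylinder. Lyapunov exponent: $\chi(\mu_{\mathbf p}):=\int_{\Sigma_m^+}\log|\phi_{\omega_1}'(\pi\sigma\omega)|\,d\mu_{\mathbf p}(\omega)$. $HD(\nu)$ is the Hausdorff dimension of the measure $\nu$, i.e. the infimum of the Hausdorff dimensions of Borel sets of full $\nu$-measure. Images of cylinders belonging to the same $G_i$ may intersect in any way. *)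

theory Defs
  imports "HOL-Probability.Probability"
begin

section \<open>Hausdorff dimension of sets and of measures\<close>

text \<open>
  The case distinction gives the usual conventions at \<open>s = 0\<close> (where \<open>0 powr 0 = 0\<close> would be wrong
  for singletons) and for empty covering sets.
\<close>

definition diam_powr :: "real \<Rightarrow> 'a::metric_space set \<Rightarrow> ennreal" where
  "diam_powr s U = (if U = {} then 0 else if s = 0 then 1 else ennreal (diameter U powr s))"

text \<open>Boundedness is required because \<^const>\<open>diameter\<close> is meaningless on unbounded sets.\<close>

definition hausdorff_premeasure :: "real \<Rightarrow> real \<Rightarrow> 'a::metric_space set \<Rightarrow> ennreal" where
  "hausdorff_premeasure s \<delta> A =
     (INF U \<in> {U :: nat \<Rightarrow> 'a set. A \<subseteq> (\<Union>k. U k) \<and> (\<forall>k. bounded (U k) \<and> diameter (U k) \<le> \<delta>)}.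
        \<Sum>k. diam_powr s (U k))"

definition hausdorff_measure :: "real \<Rightarrow> 'a::metric_space set \<Rightarrow> ennreal" where
  "hausdorff_measure s A = (SUP \<delta>\<in>{0<..}. hausdorff_premeasure s \<delta> A)"

definition hausdorff_dim :: "'a::metric_space set \<Rightarrow> ereal" where
  "hausdorff_dim A = (INF s \<in> {s. 0 \<le> s \<and> hausdorff_measure s A = 0}. ereal s)"

definition HD :: "'a::metric_space measure \<Rightarrow> ereal" where
  "HD \<nu> = (INF A \<in> {A \<in> sets \<nu>. space \<nu> - A \<in> null_sets \<nu>}. hausdorff_dim A)"


section \<open>Conformal contractions\<close>

text \<open>
  \<open>Ck_on k U f\<close> is intended for open \<open>U\<close>, where it means that \<open>f\<close> is of class \<open>C\<^sup>k\<close>: all iterated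
  directional derivatives of order at most \<open>k\<close> exist and are continuous.
\<close>

primrec Ck_on :: "nat \<Rightarrow> 'a set \<Rightarrow> ('a::real_normed_vector \<Rightarrow> 'b::real_normed_vector) \<Rightarrow> bool" where
  "Ck_on 0 U f \<longleftrightarrow> continuous_on U f"
| "Ck_on (Suc k) U f \<longleftrightarrow>
     (\<forall>x\<in>U. f differentiable (at x)) \<and> (\<forall>v. Ck_on k U (\<lambda>x. frechet_derivative f (at x) v))"

definition smooth_on :: "'a set \<Rightarrow> ('a::real_normed_vector \<Rightarrow> 'b::real_normed_vector) \<Rightarrow> bool" where
  "smooth_on U f \<longleftrightarrow> (\<forall>k. Ck_on k U f)"

definition deriv_norm :: "('a::real_normed_vector \<Rightarrow> 'b::real_normed_vector) \<Rightarrow> 'a \<Rightarrow> real" where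
  "deriv_norm f x = onorm (frechet_derivative f (at x))"

text \<open>
  The derivative is a nonzero multiple of a linear isometry; orientation-reversing maps are allowed.
\<close>

definition conformal_on :: "'a set \<Rightarrow> ('a::real_normed_vector \<Rightarrow> 'a) \<Rightarrow> bool" where
  "conformal_on U f \<longleftrightarrow>
     (\<forall>x\<in>U. f differentiable (at x) \<and>
        (\<exists>c>0. \<forall>v. norm (frechet_derivative f (at x) v) = c * norm v))"

text \<open>
  As usual, a smooth conformal map on a compact set is one that extends to such a map on an open
  neighbourhood; here \<open>f\<close> is itself the extension. This makes its derivative meaningful at the
  boundary points of \<open>V\<close>.
\<close>

definition conformal_contraction :: "'a set \<Rightarrow> ('a::real_normed_vector \<Rightarrow> 'a) \<Rightarrow> bool" where
  "conformal_contraction V f \<longleftrightarrow>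
     f ` V \<subseteq> V \<and> inj_on f V \<and> (\<exists>c<1. c-lipschitz_on V f) \<and>
     (\<exists>U. open U \<and> V \<subseteq> U \<and> smooth_on U f \<and> conformal_on U f)"


section \<open>Symbolic space, coding map and Bernoulli measures\<close>

text \<open>
  A one-sided sequence \<open>(\<omega>\<^sub>1, \<omega>\<^sub>2, \<dots>)\<close> is a function \<open>\<omega>\<close> on \<^typ>\<open>nat\<close> with \<open>\<omega> 0 = \<omega>\<^sub>1\<close>; the shift is
  \<open>\<omega> \<circ> Suc\<close>. A cylinder of length \<open>q\<close> is represented by its defining word.
\<close>

definition words :: "nat \<Rightarrow> nat \<Rightarrow> nat list set" where
  "words m q = {w. set w \<subseteq> {1..m} \<and> length w = q}"

text \<open>\<open>word_map \<phi> [i\<^sub>1, \<dots>, i\<^sub>n] = \<phi> i\<^sub>1 \<circ> \<dots> \<circ> \<phi> i\<^sub>n\<close>\<close>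

definition word_map :: "(nat \<Rightarrow> 'a \<Rightarrow> 'a) \<Rightarrow> nat list \<Rightarrow> 'a \<Rightarrow> 'a" where
  "word_map \<phi> w = foldr (\<lambda>i g. \<phi> i \<circ> g) w id"

definition coding :: "'a set \<Rightarrow> (nat \<Rightarrow> 'a \<Rightarrow> 'a) \<Rightarrow> (nat \<Rightarrow> nat) \<Rightarrow> 'a" where
  "coding V \<phi> \<omega> = (THE x. x \<in> (\<Inter>n. word_map \<phi> (map \<omega> [0..<n]) ` V))"

definition prob_vector :: "nat \<Rightarrow> (nat \<Rightarrow> real) \<Rightarrow> bool" where
  "prob_vector m p \<longleftrightarrow> (\<forall>i\<in>{1..m}. 0 \<le> p i) \<and> (\<Sum>i=1..m. p i) = 1"

definition bernoulli_measure :: "nat \<Rightarrow> (nat \<Rightarrow> real) \<Rightarrow> (nat \<Rightarrow> nat) measure" where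
  "bernoulli_measure m p = (\<Pi>\<^sub>M k\<in>UNIV. point_measure {1..m} (\<lambda>i. ennreal (p i)))"

lemma space_bernoulli_measure: "space (bernoulli_measure m p) = {\<omega>. \<forall>k. \<omega> k \<in> {1..m}}"
  by (auto simp: bernoulli_measure_def space_PiM space_point_measure PiE_def Pi_def)

lemma emeasure_bernoulli_cylinder:
  assumes p: "prob_vector m p" and w: "w \<in> words m n"
  shows "emeasure (bernoulli_measure m p) {\<omega> \<in> space (bernoulli_measure m p). map \<omega> [0..<n] = w}
       = ennreal (prod_list (map p w))"
proof -
  let ?M = "\<lambda>k::nat. point_measure {1..m} (\<lambda>i. ennreal (p i))"
  have nn: "0 \<le> p i" if "i \<in> {1..m}" for i using p that by (auto simp: prob_vector_def)
  have "prob_space (?M k)" for k :: nat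
  proof
    have "(\<Sum>i=1..m. ennreal (p i)) = 1"
      using p by (subst sum_ennreal) (auto simp: prob_vector_def)
    then show "emeasure (?M k) (space (?M k)) = 1"
      by (simp add: space_point_measure emeasure_point_measure_finite)
  qed
  then interpret product_prob_space ?M UNIV by (rule product_prob_spaceI)
  have nth: "w ! k \<in> {1..m}" if "k < n" for k
    using w that nth_mem[of k w] unfolding words_def by blast
  have ln: "length w = n" using w by (simp add: words_def)
  have eq: "{\<omega> \<in> space (bernoulli_measure m p). map \<omega> [0..<n] = w}
      = {\<omega> \<in> space (Pi\<^sub>M UNIV ?M). \<forall>k\<in>{..<n}. \<omega> k \<in> {w ! k}}"
    using ln by (auto simp: bernoulli_measure_def list_eq_iff_nth_eq)
  have "emeasure (Pi\<^sub>M UNIV ?M) {\<omega> \<in> space (Pi\<^sub>M UNIV ?M). \<forall>k\<in>{..<n}. \<omega> k \<in> {w ! k}}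
      = (\<Prod>k<n. emeasure (?M k) {w ! k})"
    using nth by (intro emeasure_PiM_Collect) (auto simp: sets_point_measure)
  also have "\<dots> = (\<Prod>k<n. ennreal (p (w ! k)))"
    using nth by (intro prod.cong) (auto simp: emeasure_point_measure_finite2)
  also have "\<dots> = ennreal (\<Prod>k<n. p (w ! k))"
    using nth nn by (intro prod_ennreal) auto
  also have "(\<Prod>k<n. p (w ! k)) = prod_list (map p w)"
    using ln by (simp add: prod.list_conv_set_nth atLeast0LessThan)
  finally show ?thesis unfolding eq by (simp add: bernoulli_measure_def)
qed

definition self_conformal_measure ::
    "'a::euclidean_space set \<Rightarrow> (nat \<Rightarrow> 'a \<Rightarrow> 'a) \<Rightarrow> nat \<Rightarrow> (nat \<Rightarrow> real) \<Rightarrow> 'a measure" where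
  "self_conformal_measure V \<phi> m p = distr (bernoulli_measure m p) borel (coding V \<phi>)"

definition lyapunov :: "'a::euclidean_space set \<Rightarrow> (nat \<Rightarrow> 'a \<Rightarrow> 'a) \<Rightarrow> (nat \<Rightarrow> nat) measure \<Rightarrow> real" where
  "lyapunov V \<phi> \<mu> = (LINT \<omega>|\<mu>. ln (deriv_norm (\<phi> (\<omega> 0)) (coding V \<phi> (\<omega> \<circ> Suc))))"

end

theory Submission
  imports Defs
begin

text \<open>
  Fix \<open>t\<close> below the claimed bound. Let \<open>m(w) = m\<^sub>i\<close> for \<open>w \<in> G\<^sub>i\<close>, extended multiplicatively to
  concatenations of words of length \<open>q\<close>. A point of \<open>W\<close> determines the group of the first block of
  any word whose image of \<open>W\<close> contains it, and after inverting that block it determines the group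
  of the next one; hence over any prefix-free family of words containing a given point in their
  images the sum of \<open>1 / m(w)\<close> is at most 1.

  Stop every sequence when the derivative \<open>|\<phi>\<^sub>w'|\<close> first drops below \<open>r\<close>. By bounded distortion the images
  of \<open>W\<close> under the stopping words contain balls of radius comparable to \<open>r\<close>, so comparing volumes
  shows that the stopping words whose image of \<open>V\<close> meets a given set of diameter at most \<open>r\<close>
  satisfy \<open>\<Sum> 1 / m(w) \<le> C\<close>. For typical words \<open>\<mu>[w] m(w) \<le> |\<phi>\<^sub>w'|\<^sup>t\<close>, because the logarithm of the quotient
  of the two sides is dominated by a sum of independent terms with negative mean once the words
  are cut into long blocks. Thus the part of the measure carried by typical sequences gives mass
  at most \<open>C r\<^sup>t\<close> to sets of diameter \<open>r\<close>, and the mass distribution principle applies.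
\<close>

section \<open>Words and overlaps\<close>

text \<open>Independence is available for letters, but the derivative at a coded point depends on
  the whole sequence, and |\<phi>_w'| is multiplicative only up to a distortion constant. Blocks of
  n words of length q repair this: the mean of log |\<phi>_w'| over a block falls short of nq times
  the Lyapunov exponent by at most a constant independent of n, and replacing |\<phi>_w'| by a
  multiplicative lower bound costs one more constant per block. The strict inequality for t gains an
  amount proportional to n, so a large n leaves a negative mean. The block length is a multiple of q
  because the overlap information concerns words of length q. Blocks then act as letters of a new
  finite alphabet, which is why the mass distribution principle is stated for an abstract alphabet
  with a size function on its words. Typical sequences of positive mass suffice, since the sets
  competing in \<open>HD\<close> have full measure and therefore carry them.\<close>

definition tuples :: "'b set \<Rightarrow> nat \<Rightarrow> 'b list set" where
  "tuples B n = {bs. set bs \<subseteq> B \<and> length bs = n}"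

lemma finite_tuples: "finite B \<Longrightarrow> finite (tuples B n)"
  unfolding tuples_def by (rule finite_lists_length_eq)

lemma sum_Cons_reindex:
  fixes h :: "'b list \<Rightarrow> 'c::comm_monoid_add"
  assumes "finite B" and "\<And>b. b \<in> B \<Longrightarrow> finite (T b)"
  shows "(\<Sum>bs\<in>(\<Union>b\<in>B. (#) b ` T b). h bs) = (\<Sum>b\<in>B. \<Sum>bs\<in>T b. h (b # bs))"
  using assms by (subst sum.UNION_disjoint) (auto simp: sum.reindex inj_on_def)

lemma tuples_0: "tuples B 0 = {[]}"
  by (auto simp: tuples_def)

lemma tuples_Suc: "tuples B (Suc n) = (\<Union>b\<in>B. (#) b ` tuples B n)"
  by (auto simp: tuples_def length_Suc_conv image_iff)

lemma sum_tuples_Suc: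
  fixes h :: "'b list \<Rightarrow> 'c::comm_monoid_add"
  assumes "finite B"
  shows "(\<Sum>bs\<in>tuples B (Suc n). h bs) = (\<Sum>b\<in>B. \<Sum>bs\<in>tuples B n. h (b # bs))"
  unfolding tuples_Suc using assms by (intro sum_Cons_reindex finite_tuples)

text \<open>With \<open>h = P\<close> this is the total mass of the words of length
  \<open>n\<close>; with an extra factor \<open>exp (s * \<xi> b)\<close> it is the factorisation of
  an exponential moment over independent letters.\<close>

lemma sum_tuples_prod_list:
  fixes h :: "'b \<Rightarrow> 'c::comm_semiring_1"
  assumes "finite B"
  shows "(\<Sum>bs\<in>tuples B n. prod_list (map h bs)) = (\<Sum>b\<in>B. h b) ^ n"
proof (induction n)
  case (Suc n)
  then show ?case
    by (simp add: sum_tuples_Suc assms flip: sum_distrib_left sum_distrib_right)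
qed (simp add: tuples_0)

text \<open>Additivity of the mean for \<open>n\<close> independent letters of law \<open>P\<close>,
  peeling off one letter at a time. It serves twice: for the letters of a word and for the words of
  a block.\<close>

lemma sum_tuples_prod_list_sum_list:
  fixes P u :: "'b \<Rightarrow> real"
  assumes "finite B" and "sum P B = 1"
  shows "(\<Sum>bs\<in>tuples B n. prod_list (map P bs) * sum_list (map u bs)) = n * (\<Sum>b\<in>B. P b * u b)"
proof (induction n)
  case (Suc n)
  have "(\<Sum>bs\<in>tuples B (Suc n). prod_list (map P bs) * sum_list (map u bs))
      = (\<Sum>b\<in>B. \<Sum>bs\<in>tuples B n. P b * u b * prod_list (map P bs)
           + P b * (prod_list (map P bs) * sum_list (map u bs)))"
    by (simp add: sum_tuples_Suc assms(1) algebra_simps)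
  also have "\<dots> = (\<Sum>b\<in>B. P b * u b) + real n * (\<Sum>b\<in>B. P b * u b)"
    using assms Suc
    by (simp add: sum.distrib sum_tuples_prod_list flip: sum_distrib_left sum_distrib_right)
  finally show ?case by (simp add: algebra_simps)
qed (simp add: tuples_0)

section \<open>Prefix-free families of words\<close>

definition prefix_free :: "'b list set \<Rightarrow> bool" where
  "prefix_free S \<longleftrightarrow> (\<forall>x z. x \<in> S \<and> x @ z \<in> S \<longrightarrow> z = [])"

lemma prefix_free_tuples: "prefix_free (tuples B n)"
  by (auto simp: prefix_free_def tuples_def)

lemma foldr_image_subset:
  assumes "\<And>b. b \<in> B \<Longrightarrow> f b ` W \<subseteq> W" and "set bs \<subseteq> B"
  shows "foldr f bs ` W \<subseteq> W"
  using assms(2) by (induction bs) (use assms(1) in \<open>auto\<close>)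

lemma foldr_inj_on:
  assumes "\<And>b. b \<in> B \<Longrightarrow> f b ` W \<subseteq> W" and "\<And>b. b \<in> B \<Longrightarrow> inj_on (f b) W" and "set bs \<subseteq> B"
  shows "inj_on (foldr f bs) W"
  using assms(3)
proof (induction bs)
  case (Cons b bs)
  then have "inj_on (foldr f bs) W" and "inj_on (f b) (foldr f bs ` W)"
    using foldr_image_subset[of B f W bs, OF assms(1)] assms(2)[of b]
    by (auto intro: inj_on_subset)
  then show ?case
    using comp_inj_on[of "foldr f bs" W "f b"] by (simp add: comp_def)
qed (simp add: inj_on_def)

text \<open>A pointwise Kraft inequality, by induction on a strict bound for the lengths. If
  \<open>[]\<close> is present, prefix-freeness leaves nothing else. Otherwise sort the words by
  first letter \<open>b\<close>: when \<open>y = f b z\<close> with \<open>z\<close> in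
  \<open>W\<close>, injectivity turns membership of \<open>y\<close> in the image of a word into
  membership of \<open>z\<close> in the image of its tail, and the tails are again prefix-free. The
  words starting with \<open>b\<close> thus contribute at most \<open>1 / mult b\<close>, and
  \<open>overlap\<close> bounds the sum over \<open>b\<close>.\<close>

lemma sum_prefix_free_le_1:
  fixes f :: "'b \<Rightarrow> 'a \<Rightarrow> 'a" and mult :: "'b \<Rightarrow> real"
  assumes B: "finite B"
    and maps: "\<And>b. b \<in> B \<Longrightarrow> f b ` W \<subseteq> W" and inj: "\<And>b. b \<in> B \<Longrightarrow> inj_on (f b) W"
    and mult: "\<And>b. b \<in> B \<Longrightarrow> mult b > 0"
    and overlap: "\<And>y. (\<Sum>b\<in>B. indicator (f b ` W) y / mult b) \<le> 1"
    and S: "finite S" "\<And>bs. bs \<in> S \<Longrightarrow> set bs \<subseteq> B" "prefix_free S"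
  shows "(\<Sum>bs\<in>S. indicator (foldr f bs ` W) y / prod_list (map mult bs)) \<le> 1"
proof -
  have "(\<Sum>bs\<in>S. indicator (foldr f bs ` W) y / prod_list (map mult bs)) \<le> 1"
    if "finite S" "\<And>bs. bs \<in> S \<Longrightarrow> set bs \<subseteq> B \<and> length bs < n" "prefix_free S" for S n
    using that
  proof (induction n arbitrary: S y)
    case 0
    then have "S = {}" by blast
    then show ?case by simp
  next
    case (Suc n)
    show ?case
    proof (cases "[] \<in> S")
      case True
      with Suc.prems(3) have "S = {[]}" by (force simp: prefix_free_def)
      then show ?thesis by (simp add: indicator_def)
    next
      case False
      define T where "T b = {bs. b # bs \<in> S}" for b
      have fin: "finite (T b)" for b
        unfolding T_def using finite_vimageI[OF Suc.prems(1), of "(#) b"]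
        by (simp add: vimage_def inj_on_def)
      have IH: "(\<Sum>bs\<in>T b. indicator (foldr f bs ` W) z / prod_list (map mult bs)) \<le> 1" for b z
        using Suc.prems by (intro Suc.IH fin) (fastforce simp: T_def prefix_free_def)+
      have "S = (\<Union>b\<in>B. (#) b ` T b)"
      proof (intro set_eqI iffI)
        fix bs assume "bs \<in> S"
        moreover from this False obtain b cs where "bs = b # cs" by (cases bs) auto
        ultimately show "bs \<in> (\<Union>b\<in>B. (#) b ` T b)"
          using Suc.prems(2)[of bs] by (auto simp: T_def)
      qed (auto simp: T_def)
      then have "(\<Sum>bs\<in>S. indicator (foldr f bs ` W) y / prod_list (map mult bs))
        = (\<Sum>b\<in>B. \<Sum>bs\<in>T b. indicator (foldr f (b # bs) ` W) y / prod_list (map mult (b # bs)))"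
        by (simp only: sum_Cons_reindex[OF B fin])
      also have "\<dots> \<le> (\<Sum>b\<in>B. indicator (f b ` W) y / mult b)"
      proof (intro sum_mono)
        fix b assume b: "b \<in> B"
        have sub: "foldr f bs ` W \<subseteq> W" if "bs \<in> T b" for bs
          using that Suc.prems(2)[of "b # bs"] by (intro foldr_image_subset[OF maps]) (auto simp: T_def)
        have im: "foldr f (b # bs) ` W = f b ` (foldr f bs ` W)" for bs
          by auto
        show "(\<Sum>bs\<in>T b. indicator (foldr f (b # bs) ` W) y / prod_list (map mult (b # bs)))
            \<le> indicator (f b ` W) y / mult b"
        proof (cases "y \<in> f b ` W")
          case True
          then obtain z where z: "z \<in> W" "y = f b z" by blast
          have "indicator (foldr f (b # bs) ` W) y = (indicator (foldr f bs ` W) z :: real)"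
            if "bs \<in> T b" for bs
            unfolding im z(2) using sub[OF that] inj[OF b] z(1)
            by (auto simp: indicator_def inj_on_def)
          then have "(\<Sum>bs\<in>T b. indicator (foldr f (b # bs) ` W) y / prod_list (map mult (b # bs)))
            = (\<Sum>bs\<in>T b. indicator (foldr f bs ` W) z / prod_list (map mult bs)) / mult b"
            unfolding sum_divide_distrib by (intro sum.cong) (auto simp: field_simps)
          also have "\<dots> \<le> 1 / mult b"
            using IH mult[OF b] by (intro divide_right_mono) auto
          finally show ?thesis using True by simp
        next
          case False
          have "y \<notin> foldr f (b # bs) ` W" if "bs \<in> T b" for bs
            using sub[OF that] False unfolding im by blast
          then show ?thesis using False by simp
        qed
      qed
      also have "\<dots> \<le> 1" by (rule overlap)
      finally show ?thesis .
    qed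
  qed
  note bound = this
  have "\<exists>n. \<forall>bs\<in>S. length bs < n"
    using finite_maxlen[OF S(1)] by blast
  then show ?thesis using bound[OF S(1)] S(2,3) by blast
qed

text \<open>As a function of \<open>s\<close> the exponential moment is 1 at \<open>s = 0\<close>,
  where its derivative is the negative mean, so it drops below 1 for small positive
  \<open>s\<close>.\<close>

lemma exists_exp_moment_less_1:
  fixes P \<xi> :: "'b \<Rightarrow> real"
  assumes "sum P B = 1" and "(\<Sum>b\<in>B. P b * \<xi> b) < 0"
  obtains s where "s > 0" "(\<Sum>b\<in>B. P b * exp (s * \<xi> b)) < 1"
proof -
  have "((\<lambda>s. \<Sum>b\<in>B. P b * exp (s * \<xi> b)) has_real_derivative (\<Sum>b\<in>B. P b * \<xi> b)) (at 0)"
    by (auto intro!: derivative_eq_intros simp: mult.commute)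
  from DERIV_neg_dec_right[OF this assms(2)] obtain d where
    "d > 0" and d: "\<And>h. 0 < h \<Longrightarrow> h < d \<Longrightarrow> (\<Sum>b\<in>B. P b * exp (h * \<xi> b)) < 1"
    using assms(1) by auto
  then show ?thesis using that[of "d / 2"] d[of "d / 2"] by simp
qed

section \<open>A mass distribution principle for coded measures\<close>

text \<open>The weighted sum of indicators is at most 1 and vanishes off \<open>cball x R\<close>,
  so its integral is at most the volume of that ball, while each term integrates to
  \<open>a i\<close> times the volume of a ball of radius \<rho>. The volume of the unit ball
  cancels.\<close>

lemma sum_ball_weights_le:
  fixes z :: "'i \<Rightarrow> 'a::euclidean_space" and a :: "'i \<Rightarrow> real"
  assumes "finite T" and a: "\<And>i. i \<in> T \<Longrightarrow> 0 \<le> a i"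
    and sub: "\<And>i. i \<in> T \<Longrightarrow> ball (z i) \<rho> \<subseteq> cball x R"
    and "0 < \<rho>" "0 \<le> R"
    and multiplicity: "\<And>y. (\<Sum>i\<in>T. a i * indicator (ball (z i) \<rho>) y) \<le> 1"
  shows "(\<Sum>i\<in>T. a i) \<le> (R / \<rho>) ^ DIM('a)"
proof -
  let ?v = "unit_ball_vol (DIM('a))"
  have v: "?v > 0" by (simp add: unit_ball_vol_def)
  have int: "integrable lborel (indicat_real (ball (z i) \<rho>))" for i
    by (intro integrable_real_indicator) (auto simp: emeasure_bounded_finite[unfolded infinity_ennreal_def])
  have "(\<Sum>i\<in>T. a i) * (?v * \<rho> ^ DIM('a)) = (\<Sum>i\<in>T. a i * (LINT y|lborel. indicat_real (ball (z i) \<rho>) y))"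
    using \<open>0 < \<rho>\<close> by (simp add: sum_distrib_right content_ball)
  also have "\<dots> = (LINT y|lborel. (\<Sum>i\<in>T. a i * indicat_real (ball (z i) \<rho>) y))"
    using int by simp
  also have "\<dots> \<le> (LINT y|lborel. indicat_real (cball x R) y)"
  proof (rule integral_mono)
    fix y
    show "(\<Sum>i\<in>T. a i * indicat_real (ball (z i) \<rho>) y) \<le> indicat_real (cball x R) y"
    proof (cases "y \<in> cball x R")
      case False
      then have "y \<notin> ball (z i) \<rho>" if "i \<in> T" for i using sub[OF that] by blast
      then show ?thesis by simp
    qed (use multiplicity in simp)
  qed (use int in \<open>auto intro!: integrable_real_indicator simp: emeasure_bounded_finite[unfolded infinity_ennreal_def]\<close>)
  also have "\<dots> = ?v * R ^ DIM('a)"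
    using \<open>0 \<le> R\<close> by (simp add: content_cball)
  finally show ?thesis
    using v \<open>0 < \<rho>\<close> by (simp add: field_simps power_divide)
qed

definition initial :: "(nat \<Rightarrow> 'b) \<Rightarrow> nat \<Rightarrow> 'b list" where
  "initial x n = map x [0..<n]"

lemma length_initial [simp]: "length (initial x n) = n"
  by (simp add: initial_def)

lemma take_initial: "k \<le> n \<Longrightarrow> take k (initial x n) = initial x k"
  by (simp add: initial_def take_map)

lemma set_initial_subset: "(\<And>k. x k \<in> B) \<Longrightarrow> set (initial x n) \<subseteq> B"
  by (auto simp: initial_def)

lemma initial_Suc: "initial x (Suc n) = initial x n @ [x n]"
  by (simp add: initial_def)

lemma initial_Suc_Cons: "initial x (Suc n) = x 0 # initial (x \<circ> Suc) n"
  unfolding initial_def by (simp add: upt_conv_Cons flip: map_Suc_upt del: upt_Suc)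

text \<open>
  \<open>D bs\<close> is the size of the image of \<open>V\<close> under the word \<open>bs\<close>, \<open>a\<close> is a multiplicative lower bound
  for it, and \<open>mult b\<close> is the number of letters that may overlap with \<open>b\<close>.
\<close>

locale coded_measure = prob_space M
  for M :: "'w measure" +
  fixes X :: "'w \<Rightarrow> nat \<Rightarrow> 'b" and point :: "'w \<Rightarrow> 'a::euclidean_space"
    and B :: "'b set" and P mult a :: "'b \<Rightarrow> real" and f :: "'b \<Rightarrow> 'a \<Rightarrow> 'a"
    and V W :: "'a set" and D :: "'b list \<Rightarrow> real" and K c :: real
  assumes finite_B: "finite B"
    and X_in: "\<And>\<omega> k. \<omega> \<in> space M \<Longrightarrow> X \<omega> k \<in> B"
    and cylinder_sets: "\<And>bs. set bs \<subseteq> B \<Longrightarrow> {\<omega> \<in> space M. initial (X \<omega>) (length bs) = bs} \<in> events"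
    and prob_cylinder: "\<And>bs. set bs \<subseteq> B \<Longrightarrow>
          prob {\<omega> \<in> space M. initial (X \<omega>) (length bs) = bs} = prod_list (map P bs)"
    and P_nonneg: "\<And>b. b \<in> B \<Longrightarrow> 0 \<le> P b" and sum_P: "sum P B = 1"
    and point_measurable: "point \<in> borel_measurable M"
    and point_in: "\<And>\<omega> n. \<omega> \<in> space M \<Longrightarrow> point \<omega> \<in> foldr f (initial (X \<omega>) n) ` V"
    and W_subset: "W \<subseteq> V"
    and maps: "\<And>b. b \<in> B \<Longrightarrow> f b ` W \<subseteq> W" and inj: "\<And>b. b \<in> B \<Longrightarrow> inj_on (f b) W"
    and mult_pos: "\<And>b. b \<in> B \<Longrightarrow> mult b > 0"
    and overlap: "\<And>y. (\<Sum>b\<in>B. indicator (f b ` W) y / mult b) \<le> 1"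
    and K: "1 \<le> K" and c: "0 < c" "c < 1"
    and D_Nil: "D [] = 1"
    and D_snoc: "\<And>bs b. set bs \<subseteq> B \<Longrightarrow> b \<in> B \<Longrightarrow> D bs / K \<le> D (bs @ [b])"
    and D_le: "\<And>bs. set bs \<subseteq> B \<Longrightarrow> D bs \<le> K * c ^ length bs"
    and dist_le: "\<And>bs x y. set bs \<subseteq> B \<Longrightarrow> x \<in> V \<Longrightarrow> y \<in> V \<Longrightarrow>
          dist (foldr f bs x) (foldr f bs y) \<le> K * D bs"
    and ball_subset: "\<And>bs. set bs \<subseteq> B \<Longrightarrow> \<exists>z. ball z (D bs / K) \<subseteq> foldr f bs ` W"
    and a_pos: "\<And>b. b \<in> B \<Longrightarrow> 0 < a b"
    and prod_a_le: "\<And>bs. set bs \<subseteq> B \<Longrightarrow> prod_list (map a bs) \<le> D bs"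
begin

text \<open>\<open>D\<close> need not decrease along prefixes, so every proper prefix is required to
  exceed \<open>r\<close>, not merely the longest one; this is what makes the family
  prefix-free.\<close>

definition stopping_words :: "real \<Rightarrow> 'b list set" where
  "stopping_words r = {bs. set bs \<subseteq> B \<and> D bs \<le> r \<and> (\<forall>k<length bs. r < D (take k bs))}"

abbreviation cylinder :: "'b list \<Rightarrow> 'w set" where
  "cylinder bs \<equiv> {\<omega> \<in> space M. initial (X \<omega>) (length bs) = bs}"

lemma eventually_D_small:
  assumes "0 < r"
  obtains n where "\<And>bs. set bs \<subseteq> B \<Longrightarrow> n \<le> length bs \<Longrightarrow> D bs \<le> r"
proof -
  obtain n where n: "c ^ n < r / K"
    using real_arch_pow_inv[of "r / K" c] assms K c by auto
  show ?thesis
  proof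
    fix bs assume "set bs \<subseteq> B" "n \<le> length bs"
    then have "D bs \<le> K * c ^ length bs" "c ^ length bs \<le> c ^ n"
      using D_le c by (auto intro: power_decreasing)
    then have "D bs \<le> K * c ^ n"
      using K by (meson mult_left_mono order_trans zero_le_one)
    also have "\<dots> \<le> r" using n K by (simp add: field_simps)
    finally show "D bs \<le> r" .
  qed
qed

text \<open>Each letter costs at most a factor \<open>K\<close>. Consequently stopping words for
  small \<open>r\<close> are long, and a condition that holds from length \<open>n0\<close> on
  applies to them.\<close>

lemma D_lower: "set bs \<subseteq> B \<Longrightarrow> (1 / K) ^ length bs \<le> D bs"
proof (induction bs rule: rev_induct)
  case (snoc b bs)
  then have "(1 / K) ^ length bs / K \<le> D bs / K"
    using K by (intro divide_right_mono) auto
  also have "\<dots> \<le> D (bs @ [b])" using snoc D_snoc by simp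
  finally show ?case by simp
qed (simp add: D_Nil)

lemma finite_stopping_words:
  assumes "0 < r"
  shows "finite (stopping_words r)"
proof -
  obtain n where n: "\<And>bs. set bs \<subseteq> B \<Longrightarrow> n \<le> length bs \<Longrightarrow> D bs \<le> r"
    using eventually_D_small[OF assms] by blast
  have "length bs \<le> n" if "bs \<in> stopping_words r" for bs
  proof (rule ccontr)
    assume "\<not> length bs \<le> n"
    then have "r < D (take n bs)" using that by (auto simp: stopping_words_def)
    moreover have "set (take n bs) \<subseteq> B"
      using that set_take_subset[of n bs] by (auto simp: stopping_words_def)
    ultimately show False using n[of "take n bs"] \<open>\<not> length bs \<le> n\<close> by simp
  qed
  then have "stopping_words r \<subseteq> {bs. set bs \<subseteq> B \<and> length bs \<le> n}"
    by (auto simp: stopping_words_def)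
  then show ?thesis
    using finite_lists_length_le[OF finite_B] finite_subset by blast
qed

lemma prefix_free_stopping_words: "prefix_free (stopping_words r)"
proof -
  have "z = []" if "x \<in> stopping_words r" "x @ z \<in> stopping_words r" for x z
  proof (rule ccontr)
    assume "z \<noteq> []"
    then have "length x < length (x @ z)" by simp
    moreover have "\<forall>k<length (x @ z). r < D (take k (x @ z))"
      using that(2) unfolding stopping_words_def mem_Collect_eq by blast
    ultimately have "r < D (take (length x) (x @ z))" by blast
    then show False using that(1) by (simp add: stopping_words_def)
  qed
  then show ?thesis by (auto simp: prefix_free_def)
qed

text \<open>Without its last letter the word still has size above \<open>r\<close>, and appending
  that letter loses at most a factor \<open>K\<close>.\<close>

lemma stopping_words_lower:
  assumes "bs \<in> stopping_words r" "0 < r" "r < 1"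
  shows "r / K \<le> D bs"
proof (cases bs rule: rev_cases)
  case Nil
  then show ?thesis using assms K by (simp add: D_Nil field_simps)
next
  case (snoc cs b)
  then have "r < D (take (length cs) bs)"
    using assms(1) unfolding stopping_words_def mem_Collect_eq
    by (metis length_append_singleton lessI)
  then have "r / K \<le> D cs / K" using K snoc by (intro divide_right_mono) auto
  also have "\<dots> \<le> D bs" using D_snoc[of cs b] assms(1) snoc by (simp add: stopping_words_def)
  finally show ?thesis .
qed

lemma exists_stopping_initial:
  assumes "\<omega> \<in> space M" "0 < r"
  obtains n where "initial (X \<omega>) n \<in> stopping_words r"
proof -
  have B: "set (initial (X \<omega>) n) \<subseteq> B" for n
    using X_in[OF assms(1)] by (intro set_initial_subset)
  have ex: "\<exists>n. D (initial (X \<omega>) n) \<le> r"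
  proof -
    obtain n where "\<And>bs. set bs \<subseteq> B \<Longrightarrow> n \<le> length bs \<Longrightarrow> D bs \<le> r"
      using eventually_D_small[OF assms(2)] by blast
    then show ?thesis using B[of n] by (intro exI[of _ n]) simp
  qed
  define n where "n = (LEAST n. D (initial (X \<omega>) n) \<le> r)"
  have "D (initial (X \<omega>) n) \<le> r" unfolding n_def by (rule LeastI_ex[OF ex])
  moreover have "r < D (initial (X \<omega>) k)" if "k < n" for k
    using not_less_Least[of k "\<lambda>n. D (initial (X \<omega>) n) \<le> r"] that by (auto simp: n_def not_le)
  ultimately show ?thesis
    using B by (intro that[of n]) (auto simp: stopping_words_def take_initial)
qed

lemma sum_stopping_words_meeting_le:
  assumes U: "bounded U" "diameter U \<le> r" and r: "0 < r" "r < 1"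
  defines "T \<equiv> {bs \<in> stopping_words r. foldr f bs ` V \<inter> U \<noteq> {}}"
  shows "(\<Sum>bs\<in>T. 1 / prod_list (map mult bs)) \<le> ((K + 1) * K\<^sup>2) ^ DIM('a)"
proof (cases "U = {}")
  case True
  then show ?thesis using K by (simp add: T_def)
next
  case False
  then obtain x where x: "x \<in> U" by blast
  \<comment> \<open>One factor \<open>K\<close> is lost between \<open>r\<close> and
    \<open>D bs\<close> for a stopping word, a second between \<open>D bs\<close> and the radius of
    a ball inside the image of \<open>W\<close>.\<close>
  define \<rho> where "\<rho> = r / K\<^sup>2"
  have \<rho>: "0 < \<rho>" using r K by (simp add: \<rho>_def)
  have finT: "finite T"
    unfolding T_def using finite_stopping_words[OF r(1)] by simp
  have TB: "set bs \<subseteq> B" if "bs \<in> T" for bs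
    using that by (auto simp: T_def stopping_words_def)
  have multT: "0 < prod_list (map mult bs)" if "bs \<in> T" for bs
    using TB[OF that] by (induction bs) (auto intro!: mult_pos_pos mult_pos)
  have "\<exists>z. ball z \<rho> \<subseteq> foldr f bs ` W" if "bs \<in> T" for bs
  proof -
    obtain z where "ball z (D bs / K) \<subseteq> foldr f bs ` W" using ball_subset[OF TB[OF \<open>bs \<in> T\<close>]] by blast
    moreover have "r / K \<le> D bs"
      using that r by (intro stopping_words_lower) (auto simp: T_def)
    then have "r / K / K \<le> D bs / K" using K by (intro divide_right_mono) auto
    then have "\<rho> \<le> D bs / K" by (simp add: \<rho>_def power2_eq_square)
    then have "ball z \<rho> \<subseteq> ball z (D bs / K)" by (rule subset_ball)
    ultimately show ?thesis by blast
  qed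
  then obtain z where z: "\<And>bs. bs \<in> T \<Longrightarrow> ball (z bs) \<rho> \<subseteq> foldr f bs ` W" by metis
  \<comment> \<open>The summand \<open>r\<close> pays for moving inside \<open>U\<close> from
    \<open>x\<close> to a point of the image, and \<open>K * r\<close> for moving inside the image,
    since \<open>D bs \<le> r\<close>.\<close>
  have near: "foldr f bs ` V \<subseteq> cball x ((K + 1) * r)" if bs: "bs \<in> T" for bs
  proof
    fix y assume "y \<in> foldr f bs ` V"
    then obtain v where v: "v \<in> V" "y = foldr f bs v" by blast
    obtain u where u: "u \<in> V" "foldr f bs u \<in> U" using bs by (auto simp: T_def)
    have "dist x y \<le> dist x (foldr f bs u) + dist (foldr f bs u) y" by (rule dist_triangle)
    also have "dist x (foldr f bs u) \<le> r"
      using diameter_bounded_bound[OF U(1) x u(2)] U(2) by linarith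
    also have "dist (foldr f bs u) y \<le> K * D bs" unfolding v(2) by (rule dist_le) (use TB bs u v in auto)
    also have "K * D bs \<le> K * r" using bs K by (intro mult_left_mono) (auto simp: T_def stopping_words_def)
    finally show "y \<in> cball x ((K + 1) * r)" by (simp add: algebra_simps)
  qed
  have "(\<Sum>bs\<in>T. 1 / prod_list (map mult bs)) \<le> ((K + 1) * r / \<rho>) ^ DIM('a)"
  proof (rule sum_ball_weights_le[where z = z and x = x])
    show "ball (z bs) \<rho> \<subseteq> cball x ((K + 1) * r)" if "bs \<in> T" for bs
      using z[OF that] near[OF that] W_subset by blast
    fix y
    \<comment> \<open>Each ball lies in the image of \<open>W\<close> under its own word, so the
      inequality for prefix-free families controls the weighted number of balls over
      \<open>y\<close>.\<close>
    have "(\<Sum>bs\<in>T. 1 / prod_list (map mult bs) * indicator (ball (z bs) \<rho>) y)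
      \<le> (\<Sum>bs\<in>T. indicator (foldr f bs ` W) y / prod_list (map mult bs))"
    proof (rule sum_mono)
      fix bs assume bs: "bs \<in> T"
      then show "1 / prod_list (map mult bs) * indicator (ball (z bs) \<rho>) y
          \<le> indicator (foldr f bs ` W) y / prod_list (map mult bs)"
        using z[OF bs] multT[OF bs] by (auto simp: indicator_def intro: less_imp_le simp del: mem_ball)
    qed
    also have "\<dots> \<le> 1"
      using finT TB prefix_free_stopping_words[of r]
      by (intro sum_prefix_free_le_1[OF finite_B maps inj mult_pos overlap])
        (auto simp: prefix_free_def T_def)
    finally show "(\<Sum>bs\<in>T. 1 / prod_list (map mult bs) * indicator (ball (z bs) \<rho>) y) \<le> 1" .
  qed (use finT multT \<rho> r K in \<open>auto intro: less_imp_le\<close>)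
  also have "(K + 1) * r / \<rho> = (K + 1) * K\<^sup>2"
    using r K by (simp add: \<rho>_def)
  finally show ?thesis .
qed

text \<open>Sizes enter through the product of the \<open>a b\<close> instead of
  \<open>D bs\<close>, so that both sides are multiplicative in the letters. As that product is at
  most \<open>D bs\<close>, for nonnegative \<open>t\<close> this is stronger than the condition
  with \<open>D bs powr t\<close>.\<close>

definition typical :: "real \<Rightarrow> 'b list \<Rightarrow> bool" where
  "typical t bs \<longleftrightarrow> prod_list (map P bs) * prod_list (map mult bs) \<le> prod_list (map a bs) powr t"

text \<open>Only finitely many words of length \<open>n\<close> occur, so any event in the first
  \<open>n\<close> letters is a finite disjoint union of cylinders. Measurability and probabilities
  follow for arbitrary \<open>Q\<close>.\<close>

lemma Collect_initial_eq:
  "{\<omega> \<in> space M. Q (initial (X \<omega>) n)} = (\<Union>bs\<in>{bs \<in> tuples B n. Q bs}. cylinder bs)"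
  using set_initial_subset[of "X _" B n] X_in by (auto simp: tuples_def)

lemma sets_initial [measurable]: "{\<omega> \<in> space M. Q (initial (X \<omega>) n)} \<in> events"
  unfolding Collect_initial_eq
  by (intro sets.finite_UN cylinder_sets) (auto simp: finite_tuples[OF finite_B], auto simp: tuples_def)

lemma prob_initial:
  "prob {\<omega> \<in> space M. Q (initial (X \<omega>) n)} = (\<Sum>bs\<in>{bs \<in> tuples B n. Q bs}. prod_list (map P bs))"
proof -
  have "finite {bs \<in> tuples B n. Q bs}" using finite_tuples[OF finite_B] by simp
  then have "prob {\<omega> \<in> space M. Q (initial (X \<omega>) n)} = (\<Sum>bs\<in>{bs \<in> tuples B n. Q bs}. prob (cylinder bs))"
    unfolding Collect_initial_eq
    by (rule finite_measure_finite_Union)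
      (auto simp: disjoint_family_on_def tuples_def intro!: cylinder_sets)
  also have "\<dots> = (\<Sum>bs\<in>{bs \<in> tuples B n. Q bs}. prod_list (map P bs))"
    by (intro sum.cong refl prob_cylinder) (auto simp: tuples_def)
  finally show ?thesis .
qed

lemma prod_list_P_nonneg: "set bs \<subseteq> B \<Longrightarrow> 0 \<le> prod_list (map P bs)"
  by (induction bs) (auto intro!: mult_nonneg_nonneg P_nonneg)

lemma prod_list_mult_pos: "set bs \<subseteq> B \<Longrightarrow> 0 < prod_list (map mult bs)"
  by (induction bs) (auto intro!: mult_pos_pos mult_pos)

lemma prod_list_a_pos: "set bs \<subseteq> B \<Longrightarrow> 0 < prod_list (map a bs)"
  by (induction bs) (auto intro!: mult_pos_pos a_pos)

definition eventually_typical :: "real \<Rightarrow> nat \<Rightarrow> 'w set" where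
  "eventually_typical t n0 = {\<omega> \<in> space M. \<forall>n\<ge>n0. typical t (initial (X \<omega>) n)}"

lemma eventually_typical_sets [measurable]: "eventually_typical t n0 \<in> events"
proof -
  have "eventually_typical t n0
      = space M \<inter> (\<Inter>n\<in>{n0..}. {\<omega> \<in> space M. typical t (initial (X \<omega>) n)})"
    by (auto simp: eventually_typical_def)
  also have "\<dots> \<in> events" by measurable
  finally show ?thesis .
qed

text \<open>A Chernoff bound and the Borel--Cantelli lemma replace the ergodic theorem.\<close>

lemma prob_eventually_typical_pos:
  assumes drift: "(\<Sum>b\<in>B. P b * \<xi> b) < 0"
    and \<xi>: "\<And>b. b \<in> B \<Longrightarrow> P b * mult b \<le> a b powr t * exp (\<xi> b)"
  obtains n0 where "0 < prob (eventually_typical t n0)"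
proof -
  obtain s where s: "s > 0" "(\<Sum>b\<in>B. P b * exp (s * \<xi> b)) < 1"
    using exists_exp_moment_less_1[OF sum_P drift] by blast
  define \<rho> where "\<rho> = (\<Sum>b\<in>B. P b * exp (s * \<xi> b))"
  have \<rho>: "0 \<le> \<rho>" "\<rho> < 1" using s(2) P_nonneg by (auto simp: \<rho>_def intro!: sum_nonneg)
  define bad where "bad n = {\<omega> \<in> space M. \<not> typical t (initial (X \<omega>) n)}" for n
  have bad_sets: "bad n \<in> events" for n unfolding bad_def by measurable
  have weight: "prod_list (map P bs) * prod_list (map mult bs)
      \<le> prod_list (map a bs) powr t * exp (sum_list (map \<xi> bs))" if "set bs \<subseteq> B" for bs
    using that
  proof (induction bs)
    case (Cons b bs)
    then have "P b * mult b * (prod_list (map P bs) * prod_list (map mult bs))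
        \<le> a b powr t * exp (\<xi> b) * (prod_list (map a bs) powr t * exp (sum_list (map \<xi> bs)))"
      using \<xi>[of b] prod_list_P_nonneg[of bs] prod_list_mult_pos[of bs]
      by (intro mult_mono[of "P b * mult b"]) auto
    moreover have "0 \<le> prod_list (map a bs)" "0 \<le> a b"
      using Cons.prems prod_list_a_pos[of bs] a_pos[of b] by auto
    ultimately show ?case by (simp add: powr_mult exp_add algebra_simps)
  qed simp
  have weight': "prod_list (map P bs) * exp (s * sum_list (map \<xi> bs))
      = prod_list (map (\<lambda>b. P b * exp (s * \<xi> b)) bs)" for bs
    by (induction bs) (auto simp: distrib_left exp_add algebra_simps)
  have "prob (bad n) \<le> \<rho> ^ n" for n
  proof -
    have "prob (bad n) = (\<Sum>bs\<in>{bs \<in> tuples B n. \<not> typical t bs}. prod_list (map P bs))"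
      unfolding bad_def by (rule prob_initial)
    also have "\<dots> \<le> (\<Sum>bs\<in>{bs \<in> tuples B n. \<not> typical t bs}.
        prod_list (map (\<lambda>b. P b * exp (s * \<xi> b)) bs))"
    proof (rule sum_mono)
      fix bs assume "bs \<in> {bs \<in> tuples B n. \<not> typical t bs}"
      then have B: "set bs \<subseteq> B" and "\<not> typical t bs" by (auto simp: tuples_def)
      \<comment> \<open>For an atypical word the bound \<open>weight\<close> forces the sum of \<xi>
        to be positive, so the factor \<open>exp (s * sum_list (map \<xi> bs)) \<ge> 1\<close> may
        be inserted. This is the Chernoff step.\<close>
      then have "prod_list (map a bs) powr t * 1 < prod_list (map a bs) powr t * exp (sum_list (map \<xi> bs))"
        using weight[OF B] by (simp add: typical_def)
      then have "0 < sum_list (map \<xi> bs)"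
        using prod_list_a_pos[OF B] by (auto simp: mult_less_cancel_left_pos)
      then have "prod_list (map P bs) * 1 \<le> prod_list (map P bs) * exp (s * sum_list (map \<xi> bs))"
        using s(1) prod_list_P_nonneg[OF B] by (intro mult_left_mono) auto
      then show "prod_list (map P bs) \<le> prod_list (map (\<lambda>b. P b * exp (s * \<xi> b)) bs)"
        by (simp add: weight')
    qed
    also have "\<dots> \<le> (\<Sum>bs\<in>tuples B n. prod_list (map (\<lambda>b. P b * exp (s * \<xi> b)) bs))"
    proof (rule sum_mono2)
      fix bs assume "bs \<in> tuples B n - {bs \<in> tuples B n. \<not> typical t bs}"
      then have "set bs \<subseteq> B" by (auto simp: tuples_def)
      then show "0 \<le> prod_list (map (\<lambda>b. P b * exp (s * \<xi> b)) bs)"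
        unfolding weight'[symmetric] using prod_list_P_nonneg by simp
    qed (auto simp: finite_tuples[OF finite_B])
    also have "\<dots> = \<rho> ^ n" by (simp add: sum_tuples_prod_list finite_B \<rho>_def)
    finally show ?thesis .
  qed
  then have "summable (\<lambda>n. prob (bad n))"
    using \<rho> by (intro summable_comparison_test'[OF summable_geometric[of \<rho>]]) auto
  then have "AE \<omega> in M. eventually (\<lambda>n. \<omega> \<in> space M - bad n) sequentially"
    using bad_sets by (intro borel_cantelli_AE1) (auto simp: emeasure_eq_measure)
  then have ae: "AE \<omega> in M. \<omega> \<in> (\<Union>n0. eventually_typical t n0)"
    by eventually_elim (auto simp: eventually_sequentially bad_def eventually_typical_def)
  \<comment> \<open>Countably many of these sets cover almost all of the space, so they cannot all
    be null.\<close>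
  have "\<exists>n0. eventually_typical t n0 \<notin> null_sets M"
  proof (rule ccontr)
    assume "\<nexists>n0. eventually_typical t n0 \<notin> null_sets M"
    then have "(\<Union>n0. eventually_typical t n0) \<in> null_sets M" by blast
    then have "AE \<omega> in M. \<omega> \<notin> (\<Union>n0. eventually_typical t n0)" by (rule AE_not_in)
    with ae have "AE \<omega> in M. False" by eventually_elim blast
    then show False by simp
  qed
  then obtain n0 where "eventually_typical t n0 \<notin> null_sets M" by blast
  then have "prob (eventually_typical t n0) \<noteq> 0"
    by (auto simp: emeasure_eq_measure null_setsI)
  then have "0 < prob (eventually_typical t n0)" by (simp add: zero_less_measure_iff)
  then show ?thesis by (rule that)
qed

text \<open>A sequence counted here passes through a stopping word whose image of \<open>V\<close>
  meets \<open>U\<close>; as \<open>r < (1 / K) ^ n0\<close>, that word has at least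
  \<open>n0\<close> letters and is therefore typical. Its cylinder has mass at most
  \<open>r powr t / prod_list (map mult bs)\<close>, and the sum of the reciprocal multiplicities is
  bounded by the volume comparison.\<close>

lemma prob_typical_meeting_le:
  assumes U: "closed U" "bounded U" "diameter U \<le> r" and r: "0 < r" "r < 1" "r < (1 / K) ^ n0"
    and "0 \<le> t"
  shows "prob (eventually_typical t n0 \<inter> (point -` U \<inter> space M)) \<le> ((K + 1) * K\<^sup>2) ^ DIM('a) * r powr t"
proof -
  define T where "T = {bs \<in> stopping_words r. foldr f bs ` V \<inter> U \<noteq> {}}"
  define T' where "T' = {bs \<in> T. typical t bs}"
  have fin: "finite T" "finite T'"
    unfolding T_def T'_def using finite_stopping_words[OF r(1)] by auto
  have TB: "set bs \<subseteq> B" if "bs \<in> T" for bs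
    using that by (auto simp: T_def stopping_words_def)
  have "eventually_typical t n0 \<inter> (point -` U \<inter> space M) \<subseteq> (\<Union>bs\<in>T'. cylinder bs)"
  proof
    fix \<omega> assume \<omega>: "\<omega> \<in> eventually_typical t n0 \<inter> (point -` U \<inter> space M)"
    then obtain n where n: "initial (X \<omega>) n \<in> stopping_words r"
      using exists_stopping_initial[of \<omega> r] r by blast
    have "(1 / K) ^ n \<le> D (initial (X \<omega>) n)" "D (initial (X \<omega>) n) \<le> r"
      using D_lower[of "initial (X \<omega>) n"] n by (auto simp: stopping_words_def)
    then have "(1 / K) ^ n < (1 / K) ^ n0" using r by linarith
    then have "n0 \<le> n"
      using K power_decreasing[of n n0 "1 / K"] by (cases "n0 \<le> n") auto
    then have "typical t (initial (X \<omega>) n)" using \<omega> by (auto simp: eventually_typical_def)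
    moreover have "point \<omega> \<in> foldr f (initial (X \<omega>) n) ` V \<inter> U" using \<omega> point_in by auto
    ultimately have "initial (X \<omega>) n \<in> T'" using n by (auto simp: T'_def T_def)
    moreover have "\<omega> \<in> cylinder (initial (X \<omega>) n)" using \<omega> by simp
    ultimately show "\<omega> \<in> (\<Union>bs\<in>T'. cylinder bs)" by (rule UN_I)
  qed
  then have "prob (eventually_typical t n0 \<inter> (point -` U \<inter> space M)) \<le> prob (\<Union>bs\<in>T'. cylinder bs)"
    using fin TB by (intro finite_measure_mono sets.finite_UN cylinder_sets) (auto simp: T'_def)
  also have "\<dots> \<le> (\<Sum>bs\<in>T'. prob (cylinder bs))"
    using fin TB by (intro finite_measure_subadditive_finite) (auto simp: T'_def intro!: cylinder_sets)
  also have "\<dots> \<le> (\<Sum>bs\<in>T'. 1 / prod_list (map mult bs) * r powr t)"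
  proof (rule sum_mono)
    fix bs assume bs: "bs \<in> T'"
    then have B: "set bs \<subseteq> B" by (auto simp: T'_def TB)
    have "prod_list (map P bs) * prod_list (map mult bs) \<le> prod_list (map a bs) powr t"
      using bs by (simp add: T'_def typical_def)
    also have "\<dots> \<le> r powr t"
      using bs prod_a_le[OF B] prod_list_a_pos[OF B] \<open>0 \<le> t\<close>
      by (intro powr_mono2) (auto simp: T'_def T_def stopping_words_def)
    finally show "prob (cylinder bs) \<le> 1 / prod_list (map mult bs) * r powr t"
      using prod_list_mult_pos[OF B] by (simp add: prob_cylinder[OF B] field_simps)
  qed
  also have "\<dots> \<le> (\<Sum>bs\<in>T. 1 / prod_list (map mult bs) * r powr t)"
    using fin prod_list_mult_pos[OF TB] by (intro sum_mono2) (auto simp: T'_def less_imp_le)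
  also have "\<dots> = (\<Sum>bs\<in>T. 1 / prod_list (map mult bs)) * r powr t"
    by (simp add: sum_distrib_right)
  also have "\<dots> \<le> ((K + 1) * K\<^sup>2) ^ DIM('a) * r powr t"
    unfolding T_def using sum_stopping_words_meeting_le[OF U(2,3) r(1,2)]
    by (intro mult_right_mono) auto
  finally show ?thesis .
qed

text \<open>Covering sets may fail to be Borel, so they are replaced by their closures, which have
  the same diameter. The natural scale is \<open>diameter U\<close>; when this is 0 and
  \<open>t > 0\<close>, arbitrarily small scales are allowed and the mass must vanish.\<close>

lemma emeasure_typical_closure_le:
  assumes U: "bounded U" "diameter U \<le> r" and r: "0 < r" "r < 1" "r < (1 / K) ^ n0"
    and t: "0 \<le> t"
  shows "emeasure M (eventually_typical t n0 \<inter> (point -` closure U \<inter> space M))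
    \<le> ennreal (((K + 1) * K\<^sup>2) ^ DIM('a)) * diam_powr t U"
proof -
  define C where "C = ((K + 1) * K\<^sup>2) ^ DIM('a)"
  have C: "0 < C" using K by (simp add: C_def)
  define \<mu> where "\<mu> = prob (eventually_typical t n0 \<inter> (point -` closure U \<inter> space M))"
  have bound: "\<mu> \<le> C * r' powr t" if "diameter U \<le> r'" "0 < r'" "r' \<le> r" for r'
    unfolding C_def \<mu>_def using that U r t
    by (intro prob_typical_meeting_le) (auto simp: diameter_closure bounded_closure)
  have "ennreal \<mu> \<le> ennreal C * diam_powr t U"
  proof (cases "U = {}")
    case True
    then show ?thesis by (simp add: \<mu>_def diam_powr_def)
  next
    case False
    consider "t = 0" | "0 < t" "0 < diameter U" | "0 < t" "diameter U = 0"
      using t diameter_ge_0[OF U(1)] by fastforce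
    then show ?thesis
    proof cases
      case 1
      then show ?thesis using bound[of r] U r C False by (auto simp: diam_powr_def)
    next
      case 2
      then show ?thesis
        using bound[of "diameter U"] U C False by (auto simp: diam_powr_def simp flip: ennreal_mult)
    next
      case 3
      have "\<mu> \<le> 0"
      proof (rule ccontr)
        assume "\<not> \<mu> \<le> 0"
        then have \<mu>: "0 < \<mu>" by simp
        \<comment> \<open>The second entry is the scale at which \<open>C * r' powr t\<close> equals
          half of the supposedly positive mass.\<close>
        define r' where "r' = min r ((\<mu> / (2 * C)) powr (1 / t))"
        have r': "0 < r'" "r' \<le> r" using r \<mu> C by (auto simp: r'_def)
        have "C * r' powr t \<le> C * ((\<mu> / (2 * C)) powr (1 / t)) powr t"
          using r' C 3 by (intro mult_left_mono powr_mono2) (auto simp: r'_def)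
        also have "\<dots> = \<mu> / 2" using 3 \<mu> C by (simp add: powr_powr)
        finally show False using bound[of r'] r' 3 \<mu> by simp
      qed
      then show ?thesis by (simp add: ennreal_neg)
    qed
  qed
  then show ?thesis by (simp add: C_def \<mu>_def emeasure_eq_measure)
qed

text \<open>Mass distribution: if the measure of \<open>A\<close> were 0, some cover at scale
  \<open>r\<close> would have sum below \<open>prob E / C\<close>. Since almost every sequence is
  coded into \<open>A\<close>, the closures of the covering sets capture almost all of
  \<open>E\<close>, and subadditivity would give \<open>prob E < prob E\<close>.\<close>

lemma hausdorff_measure_neq_0:
  assumes drift: "(\<Sum>b\<in>B. P b * \<xi> b) < 0"
    and \<xi>: "\<And>b. b \<in> B \<Longrightarrow> P b * mult b \<le> a b powr t * exp (\<xi> b)"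
    and t: "0 \<le> t" and A: "A \<in> sets borel" "AE \<omega> in M. point \<omega> \<in> A"
  shows "hausdorff_measure t A \<noteq> 0"
proof
  assume zero: "hausdorff_measure t A = 0"
  obtain n0 where n0: "0 < prob (eventually_typical t n0)"
    using prob_eventually_typical_pos[OF drift \<xi>] by blast
  define E where "E = eventually_typical t n0"
  define C where "C = ((K + 1) * K\<^sup>2) ^ DIM('a)"
  have C: "0 < C" using K by (simp add: C_def)
  \<comment> \<open>Halving makes both bounds strict: \<open>r\<close> is below 1 and below the
    threshold that forces stopping words to have at least \<open>n0\<close> letters.\<close>
  define r where "r = min (1 / 2) ((1 / K) ^ n0 / 2)"
  have r: "0 < r" "r < 1" "r < (1 / K) ^ n0" using K by (auto simp: r_def min_less_iff_disj)
  have "hausdorff_premeasure t r A \<le> hausdorff_measure t A"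
    unfolding hausdorff_measure_def using r by (intro SUP_upper) auto
  then have "hausdorff_premeasure t r A < ennreal (prob E / C)"
    using zero n0 C by (simp add: E_def)
  then obtain U where U: "A \<subseteq> (\<Union>k. U k)" "\<And>k. bounded (U k)" "\<And>k. diameter (U k) \<le> r"
    and sum: "(\<Sum>k. diam_powr t (U k)) < ennreal (prob E / C)"
    unfolding hausdorff_premeasure_def INF_less_iff by blast
  have meas: "E \<inter> (point -` closure (U k) \<inter> space M) \<in> events" for k
    using measurable_sets[OF point_measurable, of "closure (U k)"] by (simp add: E_def)
  have "emeasure M E \<le> emeasure M (\<Union>k. E \<inter> (point -` closure (U k) \<inter> space M))"
  proof (rule emeasure_mono_AE)
    show "AE \<omega> in M. \<omega> \<in> E \<longrightarrow> \<omega> \<in> (\<Union>k. E \<inter> (point -` closure (U k) \<inter> space M))"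
      using A(2) AE_space
    proof eventually_elim
      case (elim \<omega>)
      then obtain k where "point \<omega> \<in> U k" using U(1) by blast
      then have "point \<omega> \<in> closure (U k)" using closure_subset by (rule subsetD[rotated])
      then show ?case using elim by auto
    qed
  qed (use meas in \<open>intro sets.countable_UN', auto\<close>)
  also have "\<dots> \<le> (\<Sum>k. emeasure M (E \<inter> (point -` closure (U k) \<inter> space M)))"
    using meas by (intro emeasure_subadditive_countably) auto
  also have "\<dots> \<le> (\<Sum>k. ennreal C * diam_powr t (U k))"
    unfolding E_def C_def using U r t by (intro suminf_le emeasure_typical_closure_le) auto
  also have "\<dots> = ennreal C * (\<Sum>k. diam_powr t (U k))"
    by (rule ennreal_suminf_cmult)
  also have "\<dots> < ennreal C * ennreal (prob E / C)"
    using sum C by (intro ennreal_mult_strict_left_mono) auto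
  also have "\<dots> = ennreal (prob E)" using C by (simp flip: ennreal_mult')
  finally show False by (simp add: emeasure_eq_measure)
qed

end

section \<open>Bounded distortion\<close>

lemma foldr_in:
  assumes "\<And>i. i \<in> I \<Longrightarrow> \<phi> i ` V \<subseteq> V" and "set w \<subseteq> I" and "x \<in> V"
  shows "foldr \<phi> w x \<in> V"
  using foldr_image_subset[of I \<phi> V w] assms by blast

lemma exists_unit_vector: "\<exists>e::'a::euclidean_space. norm e = 1"
  using nonempty_Basis norm_Basis by blast

text \<open>\<open>g i x\<close> stands for the norm of the derivative of \<open>\<phi> i\<close> at \<open>x\<close>.\<close>

locale conformal_system =
  fixes V W :: "'a::euclidean_space set" and I :: "'i set"
    and \<phi> :: "'i \<Rightarrow> 'a \<Rightarrow> 'a" and g :: "'i \<Rightarrow> 'a \<Rightarrow> real" and c L :: real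
  assumes compact_V: "compact V" and open_W: "open W" and W_nonempty: "W \<noteq> {}" and W_subset: "W \<subseteq> V"
    and maps_V: "\<And>i. i \<in> I \<Longrightarrow> \<phi> i ` V \<subseteq> V" and maps_W: "\<And>i. i \<in> I \<Longrightarrow> \<phi> i ` W \<subseteq> W"
    and inj_V: "\<And>i. i \<in> I \<Longrightarrow> inj_on (\<phi> i) V"
    and c: "0 < c" "c < 1" and L: "0 \<le> L"
    and contraction: "\<And>i x y. i \<in> I \<Longrightarrow> x \<in> V \<Longrightarrow> y \<in> V \<Longrightarrow> dist (\<phi> i x) (\<phi> i y) \<le> c * dist x y"
    and g_pos: "\<And>i x. i \<in> I \<Longrightarrow> x \<in> V \<Longrightarrow> 0 < g i x"
    and ln_g_lipschitz: "\<And>i x y. i \<in> I \<Longrightarrow> x \<in> V \<Longrightarrow> y \<in> V \<Longrightarrow>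
      \<bar>ln (g i x) - ln (g i y)\<bar> \<le> L * dist x y"
    and quadratic: "\<And>i x y. i \<in> I \<Longrightarrow> x \<in> V \<Longrightarrow> y \<in> V \<Longrightarrow>
      \<bar>dist (\<phi> i x) (\<phi> i y) - g i x * dist x y\<bar> \<le> g i x * (L * (dist x y)\<^sup>2)"
begin

abbreviation F :: "'i list \<Rightarrow> 'a \<Rightarrow> 'a" where "F \<equiv> foldr \<phi>"

text \<open>The chain rule product for |\<phi>_w'(x)|, taken as a definition. No composite is ever
  differentiated; the geometric meaning enters through the distance estimates below.\<close>

primrec deriv_word :: "'i list \<Rightarrow> 'a \<Rightarrow> real" where
  "deriv_word [] x = 1"
| "deriv_word (i # w) x = g i (F w x) * deriv_word w x"

lemma F_in: "set w \<subseteq> I \<Longrightarrow> x \<in> V \<Longrightarrow> F w x \<in> V"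
  using maps_V by (rule foldr_in)

lemma dist_F_le: "set w \<subseteq> I \<Longrightarrow> x \<in> V \<Longrightarrow> y \<in> V \<Longrightarrow> dist (F w x) (F w y) \<le> c ^ length w * dist x y"
proof (induction w)
  case (Cons i w)
  then have "dist (F (i # w) x) (F (i # w) y) \<le> c * dist (F w x) (F w y)"
    using contraction[of i] F_in by simp
  also have "\<dots> \<le> c * (c ^ length w * dist x y)"
    using Cons c by (intro mult_left_mono) auto
  finally show ?case by simp
qed simp

lemma deriv_word_pos: "set w \<subseteq> I \<Longrightarrow> x \<in> V \<Longrightarrow> 0 < deriv_word w x"
  by (induction w) (auto intro!: mult_pos_pos g_pos F_in)

lemma deriv_word_append: "deriv_word (u @ v) x = deriv_word u (F v x) * deriv_word v x"
  by (induction u) auto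

lemma sum_power_c_le: "(\<Sum>j<n. c ^ j) \<le> 1 / (1 - c)"
proof -
  have "(\<Sum>j<n. c ^ j) \<le> (\<Sum>j. c ^ j)"
    using c by (intro sum_le_suminf summable_geometric) auto
  also have "\<dots> = 1 / (1 - c)" using c by (intro suminf_geometric) auto
  finally show ?thesis .
qed

text \<open>A letter followed by \<open>j\<close> further letters of \<open>w\<close> is evaluated
  at two points at distance at most \<open>c ^ j * dist x y\<close>, so it adds at most
  \<open>L * c ^ j * dist x y\<close>. The partial geometric sum is kept because the induction needs
  it.\<close>

lemma distortion_sum:
  "set w \<subseteq> I \<Longrightarrow> x \<in> V \<Longrightarrow> y \<in> V \<Longrightarrow>
    \<bar>ln (deriv_word w x) - ln (deriv_word w y)\<bar> \<le> L * dist x y * (\<Sum>j<length w. c ^ j)"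
proof (induction w)
  case (Cons i w)
  then have w: "set w \<subseteq> I" and i: "i \<in> I" by auto
  have "ln (deriv_word (i # w) z) = ln (g i (F w z)) + ln (deriv_word w z)" if "z \<in> V" for z
    using g_pos[OF i F_in[OF w that]] deriv_word_pos[OF w that] by (simp add: ln_mult)
  moreover have "\<bar>ln (g i (F w x)) - ln (g i (F w y))\<bar> \<le> L * dist (F w x) (F w y)"
    using Cons i w by (intro ln_g_lipschitz F_in)
  moreover have "L * dist (F w x) (F w y) \<le> L * (c ^ length w * dist x y)"
    using Cons w L by (intro mult_left_mono dist_F_le) auto
  ultimately show ?case using Cons by (simp add: algebra_simps)
qed simp

lemma distortion:
  assumes "set w \<subseteq> I" "x \<in> V" "y \<in> V"
  shows "\<bar>ln (deriv_word w x) - ln (deriv_word w y)\<bar> \<le> L * dist x y / (1 - c)"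
proof -
  have "L * dist x y * (\<Sum>j<length w. c ^ j) \<le> L * dist x y * (1 / (1 - c))"
    using L sum_power_c_le by (intro mult_left_mono) auto
  then show ?thesis using distortion_sum[OF assms] by simp
qed

lemma dist_F_upper:
  "set w \<subseteq> I \<Longrightarrow> x \<in> V \<Longrightarrow> y \<in> V \<Longrightarrow>
    dist (F w x) (F w y) \<le> deriv_word w x * dist x y * exp (L * dist x y * (\<Sum>j<length w. c ^ j))"
proof (induction w)
  case (Cons i w)
  then have w: "set w \<subseteq> I" and i: "i \<in> I" by auto
  let ?d = "dist (F w x) (F w y)" and ?e = "L * dist x y * (\<Sum>j<length w. c ^ j)"
  have Fx: "F w x \<in> V" "F w y \<in> V" using F_in w Cons by auto
  have "dist (F (i # w) x) (F (i # w) y) \<le> g i (F w x) * ?d + g i (F w x) * (L * ?d\<^sup>2)"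
    using quadratic[OF i Fx] by simp
  also have "\<dots> = g i (F w x) * ?d * (1 + L * ?d)" by (simp add: power2_eq_square algebra_simps)
  also have "\<dots> \<le> g i (F w x) * (deriv_word w x * dist x y * exp ?e) * exp (L * (c ^ length w * dist x y))"
  proof (intro mult_mono)
    show "?d \<le> deriv_word w x * dist x y * exp ?e" using Cons w by simp
    have "1 + L * ?d \<le> exp (L * ?d)" by (rule exp_ge_add_one_self)
    also have "\<dots> \<le> exp (L * (c ^ length w * dist x y))"
      using dist_F_le[OF w] Cons L by (auto intro!: mult_left_mono)
    finally show "1 + L * ?d \<le> exp (L * (c ^ length w * dist x y))" .
  qed (use less_imp_le[OF g_pos[OF i Fx(1)]] less_imp_le[OF deriv_word_pos[OF w]] Cons L in
      \<open>auto intro!: mult_nonneg_nonneg\<close>)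
  finally show ?case by (simp add: algebra_simps exp_add)
qed simp

text \<open>Each letter now costs a factor \<open>1 - L * d\<close>. The product of these factors is
  bounded below by 1 minus the sum, and smallness of \<open>dist x y\<close> keeps all of them
  positive.\<close>

lemma dist_F_lower:
  assumes "x \<in> V" "y \<in> V" and small: "L * dist x y / (1 - c) \<le> 1 / 2"
  shows "set w \<subseteq> I \<Longrightarrow>
    deriv_word w x * dist x y * (1 - L * dist x y * (\<Sum>j<length w. c ^ j)) \<le> dist (F w x) (F w y)"
proof (induction w)
  case (Cons i w)
  then have w: "set w \<subseteq> I" and i: "i \<in> I" by auto
  let ?d = "dist (F w x) (F w y)" and ?l = "L * dist x y"
  let ?S = "?l * (\<Sum>j<length w. c ^ j)" and ?t = "?l * c ^ length w"
  have Fx: "F w x \<in> V" "F w y \<in> V" using F_in w assms by auto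
  have l: "0 \<le> ?l" using L by simp
  have sum_le: "?l * (\<Sum>j<n. c ^ j) \<le> 1 / 2" for n
    using mult_left_mono[OF sum_power_c_le[of n] l] small
    unfolding times_divide_eq_right mult_1_right by linarith
  have S: "0 \<le> ?S" "?S \<le> 1 / 2" using l c sum_le by (auto intro!: mult_nonneg_nonneg sum_nonneg)
  have t: "0 \<le> ?t" "?S + ?t \<le> 1 / 2"
    using sum_le[of "Suc (length w)"] l c by (auto simp: distrib_left)
  have "(1 - ?S) * (1 - ?t) = 1 - ?S - ?t + ?S * ?t" by (simp add: algebra_simps)
  then have "1 - ?S - ?t \<le> (1 - ?S) * (1 - ?t)" using mult_nonneg_nonneg[OF S(1) t(1)] by linarith
  then have "deriv_word w x * dist x y * (1 - ?S - ?t) \<le> deriv_word w x * dist x y * ((1 - ?S) * (1 - ?t))"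
    using deriv_word_pos[OF w assms(1)] by (intro mult_left_mono) auto
  also have "\<dots> = (deriv_word w x * dist x y * (1 - ?S)) * (1 - ?t)" by simp
  also have "\<dots> \<le> ?d * (1 - L * ?d)"
  proof (intro mult_mono)
    show "deriv_word w x * dist x y * (1 - ?S) \<le> ?d" using Cons by simp
    show "1 - ?t \<le> 1 - L * ?d"
      using mult_left_mono[OF dist_F_le[OF w assms(1,2)] L] by (simp add: algebra_simps)
  qed (use S t in auto)
  finally have "g i (F w x) * (deriv_word w x * dist x y * (1 - ?S - ?t)) \<le> g i (F w x) * (?d * (1 - L * ?d))"
    using g_pos[OF i Fx(1)] by (intro mult_left_mono) auto
  also have "\<dots> = g i (F w x) * ?d - g i (F w x) * (L * ?d\<^sup>2)" by (simp add: power2_eq_square algebra_simps)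
  also have "\<dots> \<le> dist (F (i # w) x) (F (i # w) y)"
    using quadratic[OF i Fx] by simp
  finally show ?case by (simp add: algebra_simps)
qed simp

lemma dist_F_lower_half:
  assumes "x \<in> V" "y \<in> V" "L * dist x y / (1 - c) \<le> 1 / 2" "set w \<subseteq> I"
  shows "deriv_word w x * dist x y / 2 \<le> dist (F w x) (F w y)"
proof -
  have "L * dist x y * (\<Sum>j<length w. c ^ j) \<le> L * dist x y * (1 / (1 - c))"
    using L sum_power_c_le by (intro mult_left_mono) auto
  then have "1 / 2 \<le> 1 - L * dist x y * (\<Sum>j<length w. c ^ j)"
    using assms(3) unfolding times_divide_eq_right mult_1_right by linarith
  then have "deriv_word w x * dist x y * (1 / 2) \<le> deriv_word w x * dist x y * (1 - L * dist x y * (\<Sum>j<length w. c ^ j))"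
    using deriv_word_pos[OF assms(4,1)] by (intro mult_left_mono) auto
  also have "\<dots> \<le> dist (F w x) (F w y)" using assms by (intro dist_F_lower)
  finally show ?thesis by simp
qed

lemma continuous_F:
  assumes "set w \<subseteq> I" shows "continuous_on V (F w)"
  using dist_F_le[OF assms] c
  by (intro lipschitz_on_continuous_on[where L = "c ^ length w"]) (auto intro!: lipschitz_onI)

lemma inj_F: "set w \<subseteq> I \<Longrightarrow> inj_on (F w) V"
  using maps_V inj_V by (rule foldr_inj_on)

text \<open>By invariance of domain the image \<open>?S\<close> of the open ball around
  \<open>x0\<close> is open, so its frontier comes from the sphere of radius \<rho>, whose image
  stays at distance at least \<open>deriv_word w x0 * \<rho> / 2\<close> from \<open>F w x0\<close>.
  The smaller ball around \<open>F w x0\<close> is connected, meets \<open>?S\<close> and misses the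
  frontier, hence lies in \<open>?S\<close>.\<close>

lemma ball_subset_F:
  assumes x0: "cball x0 \<rho> \<subseteq> W" "0 < \<rho>" and small: "L * \<rho> / (1 - c) \<le> 1 / 2" and w: "set w \<subseteq> I"
  shows "ball (F w x0) (deriv_word w x0 * \<rho> / 2) \<subseteq> F w ` W"
proof
  fix y assume y: "y \<in> ball (F w x0) (deriv_word w x0 * \<rho> / 2)"
  have V: "cball x0 \<rho> \<subseteq> V" using x0 W_subset by blast
  then have x0V: "x0 \<in> V" using x0(2) by auto
  let ?S = "F w ` ball x0 \<rho>"
  have openS: "open ?S"
    using V continuous_on_subset[OF continuous_F[OF w]] inj_on_subset[OF inj_F[OF w]]
    by (intro invariance_of_domain) (auto simp: subset_iff)
  have "compact (F w ` cball x0 \<rho>)"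
    using continuous_on_subset[OF continuous_F[OF w] V] by (intro compact_continuous_image) auto
  then have closure_S: "closure ?S \<subseteq> F w ` cball x0 \<rho>"
    by (intro closure_minimal compact_imp_closed) (auto intro: less_imp_le)
  have "y \<in> ?S"
  proof (rule ccontr)
    assume "y \<notin> ?S"
    then have ne: "ball (F w x0) (deriv_word w x0 * \<rho> / 2) - ?S \<noteq> {}" using y by blast
    have "F w x0 \<in> ball (F w x0) (deriv_word w x0 * \<rho> / 2) \<inter> ?S"
      using deriv_word_pos[OF w x0V] x0(2) by simp
    then have "ball (F w x0) (deriv_word w x0 * \<rho> / 2) \<inter> ?S \<noteq> {}" by blast
    then have "ball (F w x0) (deriv_word w x0 * \<rho> / 2) \<inter> frontier ?S \<noteq> {}"
      using ne by (rule connected_Int_frontier[OF connected_ball])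
    then obtain z where z: "dist (F w x0) z < deriv_word w x0 * \<rho> / 2" "z \<in> closure ?S" "z \<notin> ?S"
      using openS by (auto simp: frontier_def interior_open)
    then obtain v where v: "v \<in> cball x0 \<rho>" "z = F w v" using closure_S by blast
    then have "dist x0 v = \<rho>" using z(3) by (cases "dist x0 v < \<rho>") auto
    then have "deriv_word w x0 * \<rho> / 2 \<le> dist (F w x0) z"
      using dist_F_lower_half[of x0 v w] x0V V v small w by auto
    then show False using z(1) by simp
  qed
  then show "y \<in> F w ` W" using x0 by (auto simp: subset_iff less_imp_le)
qed

text \<open>One base point and one constant for all words: sizes are measured by
  \<open>deriv_word w x0\<close>, which later provides the size function of the coded
  measure.\<close>

lemma uniform_geometry:
  obtains x0 K where "x0 \<in> W" "1 \<le> K"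
    "\<And>w x y. set w \<subseteq> I \<Longrightarrow> x \<in> V \<Longrightarrow> y \<in> V \<Longrightarrow> deriv_word w x \<le> K * deriv_word w y"
    "\<And>w x y. set w \<subseteq> I \<Longrightarrow> x \<in> V \<Longrightarrow> y \<in> V \<Longrightarrow> dist (F w x) (F w y) \<le> K * deriv_word w x0"
    "\<And>w. set w \<subseteq> I \<Longrightarrow> ball (F w x0) (deriv_word w x0 / K) \<subseteq> F w ` W"
    "\<And>w. set w \<subseteq> I \<Longrightarrow> deriv_word w x0 \<le> K * c ^ length w"
proof -
  obtain x0 where x0: "x0 \<in> W" using W_nonempty by blast
  obtain \<epsilon> where \<epsilon>: "\<epsilon> > 0" "cball x0 \<epsilon> \<subseteq> W"
    using open_W x0 open_contains_cball by blast
  \<comment> \<open>Small enough for the lower distance bound with factor one half;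
    \<open>L + 1\<close> avoids a division by zero when \<open>L = 0\<close>.\<close>
  define \<rho> where "\<rho> = min \<epsilon> ((1 - c) / (2 * (L + 1)))"
  have \<rho>: "0 < \<rho>" using \<epsilon>(1) c L by (simp add: \<rho>_def)
  have cball: "cball x0 \<rho> \<subseteq> W" using \<epsilon>(2) by (auto simp: \<rho>_def)
  have "L * \<rho> \<le> (L + 1) * ((1 - c) / (2 * (L + 1)))"
    using L \<rho> by (intro mult_mono) (auto simp: \<rho>_def)
  also have "\<dots> = (1 - c) / 2" using L by (auto simp: divide_simps)
  finally have small: "L * \<rho> / (1 - c) \<le> 1 / 2" using c by (simp add: field_simps)
  have x0V: "x0 \<in> V" using x0 W_subset by blast
  define \<delta> where "\<delta> = diameter V"
  have \<delta>: "dist x y \<le> \<delta>" if "x \<in> V" "y \<in> V" for x y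
    unfolding \<delta>_def using compact_imp_bounded[OF compact_V] that by (rule diameter_bounded_bound)
  have \<delta>0: "0 \<le> \<delta>" using \<delta>[OF x0V x0V] by simp
  define \<kappa> where "\<kappa> = exp (L * \<delta> / (1 - c))"
  have \<kappa>: "1 \<le> \<kappa>" using L c \<delta>0 by (simp add: \<kappa>_def)
  have dist_exp: "exp (L * dist x y * s) \<le> \<kappa>" if "x \<in> V" "y \<in> V" "0 \<le> s" "s \<le> 1 / (1 - c)" for x y s
  proof -
    have "L * dist x y * s \<le> L * \<delta> * (1 / (1 - c))"
      using \<delta>[OF that(1,2)] L that \<delta>0 by (intro mult_mono) auto
    then show ?thesis by (simp add: \<kappa>_def)
  qed
  \<comment> \<open>One summand for each use: \<open>2 / \<rho>\<close> for the inscribed ball, 2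
    for exponential decay, \<kappa> for distortion, and the last one for the diameter of the image
    of \<open>V\<close>.\<close>
  define K where "K = 2 / \<rho> + 2 + \<kappa> + \<kappa> * (\<delta> * \<kappa>)"
  have K: "2 / \<rho> \<le> K" "2 \<le> K" "1 \<le> K" "\<kappa> \<le> K" "\<kappa> * (\<delta> * \<kappa>) \<le> K"
    using \<rho> \<kappa> \<delta>0 by (auto simp: K_def add_nonneg_nonneg)
  show ?thesis
  proof (rule that[OF x0 K(3)])
    have dist: "deriv_word w x \<le> \<kappa> * deriv_word w y" if "set w \<subseteq> I" "x \<in> V" "y \<in> V" for w x y
    proof -
      have pos: "0 < deriv_word w x" "0 < deriv_word w y" using deriv_word_pos that by auto
      have "ln (deriv_word w x) \<le> ln (deriv_word w y) + L * dist x y * (1 / (1 - c))"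
        using distortion[OF that] by simp
      then have "deriv_word w x \<le> deriv_word w y * exp (L * dist x y * (1 / (1 - c)))"
        using pos by (metis exp_add exp_le_cancel_iff exp_ln)
      also have "\<dots> \<le> deriv_word w y * \<kappa>"
        using pos c that by (intro mult_left_mono dist_exp) auto
      finally show ?thesis by (simp add: mult.commute)
    qed
    fix w assume w: "set w \<subseteq> I"
    have D: "0 < deriv_word w x0" using deriv_word_pos[OF w x0V] .
    show "deriv_word w x \<le> K * deriv_word w y" if "x \<in> V" "y \<in> V" for x y
      using dist[OF w that] mult_right_mono[OF K(4)] deriv_word_pos[OF w that(2)]
      by (meson less_imp_le order_trans)
    show "dist (F w x) (F w y) \<le> K * deriv_word w x0" if "x \<in> V" "y \<in> V" for x y
    proof -
      have "dist (F w x) (F w y) \<le> deriv_word w x * dist x y * exp (L * dist x y * (\<Sum>j<length w. c ^ j))"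
        using w that by (rule dist_F_upper)
      also have "\<dots> \<le> \<kappa> * deriv_word w x0 * \<delta> * \<kappa>"
        using that w \<delta>0 \<kappa> less_imp_le[OF D] c sum_power_c_le
        by (intro mult_mono dist dist_exp \<delta> x0V) (auto intro!: sum_nonneg mult_nonneg_nonneg)
      also have "\<dots> = \<kappa> * (\<delta> * \<kappa>) * deriv_word w x0" by simp
      also have "\<dots> \<le> K * deriv_word w x0" using K D by (intro mult_right_mono) auto
      finally show ?thesis .
    qed
    have "1 / K \<le> 1 / (2 / \<rho>)" using K \<rho> by (intro divide_left_mono) auto
    then have "1 / K * deriv_word w x0 \<le> \<rho> / 2 * deriv_word w x0"
      using D by (intro mult_right_mono) auto
    then have "deriv_word w x0 / K \<le> deriv_word w x0 * \<rho> / 2" by (simp add: algebra_simps)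
    then have "ball (F w x0) (deriv_word w x0 / K) \<subseteq> ball (F w x0) (deriv_word w x0 * \<rho> / 2)"
      by (rule subset_ball)
    then show "ball (F w x0) (deriv_word w x0 / K) \<subseteq> F w ` W"
      using ball_subset_F[OF cball \<rho> small w] by blast
    \<comment> \<open>A second point at distance exactly \<rho> from \<open>x0\<close> is enough:
      its image distance is at least half the derivative times \<rho>, and at most
      \<open>c ^ length w * \<rho>\<close>.\<close>
    obtain e :: 'a where e: "norm e = 1" using exists_unit_vector by blast
    let ?y = "x0 + \<rho> *\<^sub>R e"
    have d: "dist x0 ?y = \<rho>" using e \<rho> by (simp add: dist_norm)
    then have "?y \<in> V" using cball W_subset by (auto simp: subset_iff)
    then have "deriv_word w x0 * \<rho> / 2 \<le> c ^ length w * \<rho>"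
      using dist_F_lower_half[OF x0V _ _ w, of ?y] dist_F_le[OF w x0V, of ?y] small unfolding d by simp
    then have "deriv_word w x0 \<le> 2 * c ^ length w" using \<rho> by (simp add: field_simps)
    also have "\<dots> \<le> K * c ^ length w" using K c by (intro mult_right_mono) auto
    finally show "deriv_word w x0 \<le> K * c ^ length w" .
  qed
qed

end

text \<open>Two continuous derivatives give the estimates for points closer than some \<epsilon>,
  because balls of that radius around \<open>V\<close> stay in \<open>U\<close>. Distant pairs are
  handled by crude bounds divided by \<epsilon>, which makes convexity of \<open>V\<close>
  unnecessary.\<close>

lemma C2_bounds:
  fixes f :: "'a::euclidean_space \<Rightarrow> 'a"
  assumes V: "compact V" "V \<subseteq> U" and "open U"
    and smooth: "smooth_on U f" and conformal: "conformal_on U f"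
    and lip: "c-lipschitz_on V f"
  obtains L where "0 \<le> L"
    and "\<And>x. x \<in> V \<Longrightarrow> 0 < deriv_norm f x"
    and "\<And>x y. x \<in> V \<Longrightarrow> y \<in> V \<Longrightarrow> \<bar>ln (deriv_norm f x) - ln (deriv_norm f y)\<bar> \<le> L * dist x y"
    and "\<And>x y. x \<in> V \<Longrightarrow> y \<in> V \<Longrightarrow>
      \<bar>dist (f x) (f y) - deriv_norm f x * dist x y\<bar> \<le> deriv_norm f x * (L * (dist x y)\<^sup>2)"
proof (cases "V = {}")
  case True
  then show ?thesis by (intro that[of 0]) auto
next
  case False
  define A where "A x = frechet_derivative f (at x)" for x
  define A' where "A' e x = frechet_derivative (\<lambda>x. A x e) (at x)" for e x
  let ?g = "deriv_norm f"
  have Ck2: "Ck_on (Suc (Suc 0)) U f" using smooth unfolding smooth_on_def by blast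
  then have f: "(f has_derivative A x) (at x)" if "x \<in> U" for x
    using that unfolding A_def by (simp flip: frechet_derivative_works)
  have A: "((\<lambda>x. A x e) has_derivative A' e x) (at x)" if "x \<in> U" for x e
    using that Ck2 unfolding A'_def A_def by (simp flip: frechet_derivative_works)
  have A'_cont: "continuous_on U (\<lambda>x. A' e x b)" for e b
    using Ck2 unfolding A'_def A_def by simp
  have lin: "bounded_linear (A x)" if "x \<in> U" for x
    using f[OF that] by (rule has_derivative_bounded_linear)
  \<comment> \<open>For a conformal derivative the operator norm is the scaling factor itself, as a
    single basis vector shows.\<close>
  have conf: "0 < ?g x \<and> (\<forall>v. norm (A x v) = ?g x * norm v)" if "x \<in> U" for x
  proof -
    obtain k where k: "k > 0" "\<And>v. norm (A x v) = k * norm v"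
      using conformal \<open>x \<in> U\<close> unfolding conformal_on_def A_def by blast
    have "onorm (A x) = k"
    proof (rule antisym)
      show "onorm (A x) \<le> k" using k by (intro onorm_le) simp
      obtain e :: 'a where "e \<in> Basis" using nonempty_Basis by blast
      then have "k = norm (A x e)" by (simp add: k(2))
      also have "\<dots> \<le> onorm (A x)"
        using onorm[OF lin[OF that], of e] \<open>e \<in> Basis\<close> by simp
      finally show "k \<le> onorm (A x)" .
    qed
    then show ?thesis using k by (simp add: deriv_norm_def A_def)
  qed
  obtain \<epsilon> where \<epsilon>: "\<epsilon> > 0" "(\<Union>x\<in>V. cball x \<epsilon>) \<subseteq> U"
    using compact_subset_open_imp_cball_epsilon_subset[OF V(1) \<open>open U\<close> V(2)] by blast
  let ?N = "\<Union>x\<in>V. cball x \<epsilon>"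
  \<comment> \<open>All second partial derivatives at once: this sum is continuous, so it is bounded
    on the compact neighbourhood \<open>?N\<close>, and it dominates the operator norm of every
    \<open>A' e x\<close> with \<open>e\<close> in \<open>Basis\<close>.\<close>
  let ?h = "\<lambda>x. \<Sum>e\<in>Basis. \<Sum>b\<in>Basis. norm (A' e x b)"
  have "continuous_on ?N ?h"
    by (intro continuous_intros continuous_on_subset[OF A'_cont \<epsilon>(2)])
  then have "bounded (?h ` ?N)"
    using compact_minkowski_sum_cball[OF V(1)] by (intro compact_imp_bounded compact_continuous_image)
  then obtain C where C: "\<And>x. x \<in> ?N \<Longrightarrow> norm (?h x) \<le> C"
    unfolding bounded_iff by blast
  have C0: "0 \<le> C"
  proof -
    obtain x where "x \<in> V" using False by blast
    then have "x \<in> ?N" using \<epsilon>(1) by (intro UN_I[of x]) auto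
    then show ?thesis using C norm_ge_zero order_trans by blast
  qed
  have A'_le: "onorm (A' e x) \<le> C" if "x \<in> ?N" "e \<in> Basis" for x e
  proof -
    have "onorm (A' e x) \<le> (\<Sum>b\<in>Basis. norm (A' e x b))"
      using that(1) \<epsilon>(2) by (intro onorm_componentwise has_derivative_bounded_linear[OF A]) blast
    also have "\<dots> \<le> ?h x"
      using that(2) by (intro member_le_sum) (auto intro: sum_nonneg)
    also have "\<dots> \<le> C" using C[OF that(1)] by simp
    finally show ?thesis .
  qed
  define C1 where "C1 = DIM('a) * C"
  have A_near: "norm (A y e - A x e) \<le> C * norm (y - x)"
    if "x \<in> V" "y \<in> cball x \<epsilon>" "e \<in> Basis" for x y e
  proof (rule differentiable_bound[of "cball x \<epsilon>" _ "A' e"])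
    fix z assume z: "z \<in> cball x \<epsilon>"
    then have "z \<in> ?N" using that(1) by blast
    then show "((\<lambda>x. A x e) has_derivative A' e z) (at z within cball x \<epsilon>)" "onorm (A' e z) \<le> C"
      using A \<epsilon>(2) A'_le that(3) by (blast intro: has_derivative_at_withinI)+
  qed (use that \<epsilon>(1) in auto)
  have A_near_onorm: "onorm (A y - A x) \<le> C1 * norm (y - x)" if "x \<in> V" "y \<in> cball x \<epsilon>" for x y
  proof -
    have "x \<in> U" "y \<in> U" using that V(2) \<epsilon>(2) by blast+
    then have "bounded_linear (A y - A x)"
      using bounded_linear_sub[OF lin lin] by (simp add: fun_diff_def)
    then have "onorm (A y - A x) \<le> (\<Sum>e\<in>Basis. norm ((A y - A x) e))"
      by (rule onorm_componentwise)
    also have "\<dots> \<le> (\<Sum>e\<in>(Basis :: 'a set). C * norm (y - x))"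
      using A_near[OF that] by (intro sum_mono) simp
    also have "\<dots> = C1 * norm (y - x)" by (simp add: C1_def)
    finally show ?thesis .
  qed
  have taylor: "\<bar>dist (f x) (f y) - ?g x * dist x y\<bar> \<le> C1 * (dist x y)\<^sup>2"
    if "x \<in> V" "y \<in> V" "dist x y \<le> \<epsilon>" for x y
  proof -
    let ?B = "cball x (dist x y)"
    have sub: "?B \<subseteq> cball x \<epsilon>" using that by (intro subset_cball)
    \<comment> \<open>The ball \<open>?B\<close> lies in \<open>U\<close> and contains the segment
      from \<open>x\<close> to \<open>y\<close>; on it the derivative stays within
      \<open>C1 * norm (y - x)\<close> of \<open>A x\<close>.\<close>
    have "norm (f y - f x - A x (y - x)) \<le> norm (y - x) * (C1 * norm (y - x))"
    proof (rule differentiable_bound_linearization[of x y ?B f A])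
      fix z assume z: "z \<in> ?B"
      then have "z \<in> U" using sub \<epsilon>(2) that(1) by blast
      then show "(f has_derivative A z) (at z within ?B)"
        by (rule has_derivative_at_withinI[OF f])
      have "onorm (A z - A x) \<le> C1 * norm (z - x)"
        using z sub that(1) by (intro A_near_onorm) blast+
      also have "\<dots> \<le> C1 * norm (y - x)"
        using z C0
        by (intro mult_left_mono) (simp_all add: C1_def dist_norm norm_minus_commute[of x z] norm_minus_commute[of x y])
      finally show "onorm (A z - A x) \<le> C1 * norm (y - x)" .
    next
      fix \<tau> :: real assume "\<tau> \<in> {0..1}"
      then have "\<bar>\<tau>\<bar> * norm (y - x) \<le> norm (y - x)" by (intro mult_left_le_one_le) auto
      then show "x + \<tau> *\<^sub>R (y - x) \<in> ?B" by (simp add: dist_norm norm_minus_commute[of x y])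
    qed simp
    moreover have "\<bar>norm (f y - f x) - norm (A x (y - x))\<bar> \<le> norm (f y - f x - A x (y - x))"
      by (rule norm_triangle_ineq3)
    moreover have "norm (A x (y - x)) = ?g x * dist x y"
      using conf[of x] that(1) V(2) by (auto simp: dist_norm norm_minus_commute[of x y])
    ultimately show ?thesis
      by (simp add: dist_norm norm_minus_commute[of x y] norm_minus_commute[of "f x" "f y"] power2_eq_square mult.commute mult.left_commute)
  qed
  obtain e :: 'a where e: "e \<in> Basis" using nonempty_Basis by blast
  have g_eq: "?g x = norm (A x e)" if "x \<in> U" for x using conf[OF that] e by simp
  have g_near: "\<bar>?g x - ?g y\<bar> \<le> C * dist x y" if "x \<in> V" "y \<in> V" "dist x y \<le> \<epsilon>" for x y
  proof -
    have "\<bar>norm (A y e) - norm (A x e)\<bar> \<le> norm (A y e - A x e)" by (rule norm_triangle_ineq3)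
    also have "\<dots> \<le> C * norm (y - x)" using that e by (intro A_near) auto
    finally show ?thesis
      using that V(2) by (simp add: g_eq subset_iff dist_norm norm_minus_commute[of x y] abs_minus_commute)
  qed
  have "continuous_on V (\<lambda>x. norm (A x e))"
    using A[of _ e] V(2)
    by (intro continuous_intros differentiable_imp_continuous_on)
      (auto simp: differentiable_on_def differentiable_def intro: has_derivative_at_withinI)
  then have g_cont: "continuous_on V ?g"
    using V(2) by (subst continuous_on_cong[OF refl g_eq]) auto
  obtain \<gamma> where \<gamma>: "\<gamma> > 0" "\<And>x. x \<in> V \<Longrightarrow> \<gamma> \<le> ?g x"
    using continuous_attains_inf[OF V(1) False g_cont] conf V(2) by blast
  obtain \<Gamma> where \<Gamma>: "\<And>x. x \<in> V \<Longrightarrow> ?g x \<le> \<Gamma>"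
    using continuous_attains_sup[OF V(1) False g_cont] by blast
  have \<Gamma>0: "0 \<le> \<Gamma>" using False \<gamma> \<Gamma> by fastforce
  have c0: "0 \<le> c" using lip by (rule lipschitz_on_nonneg)
  \<comment> \<open>\<open>C1\<close> and \<open>C\<close> serve pairs at distance at most
    \<epsilon>. For the others \<open>dist x y / \<epsilon>\<close> exceeds 1 and absorbs the crude
    size \<open>c + \<Gamma>\<close>.\<close>
  define M where "M = C1 + C + (c + \<Gamma>) / \<epsilon>"
  have C10: "0 \<le> C1" using C0 by (simp add: C1_def)
  have M: "C1 \<le> M" "C \<le> M" "\<Gamma> / \<epsilon> \<le> M" "(c + \<Gamma>) / \<epsilon> \<le> M" "0 \<le> M"
    using C0 C10 c0 \<Gamma>0 \<epsilon>(1) by (auto simp: M_def add_divide_distrib add_nonneg_nonneg)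
  have g_lip: "\<bar>?g x - ?g y\<bar> \<le> M * dist x y" if "x \<in> V" "y \<in> V" for x y
  proof (cases "dist x y \<le> \<epsilon>")
    case True
    have "\<bar>?g x - ?g y\<bar> \<le> C * dist x y" by (rule g_near[OF that True])
    also have "\<dots> \<le> M * dist x y" using M by (intro mult_right_mono) auto
    finally show ?thesis .
  next
    case False
    have "\<bar>?g x - ?g y\<bar> \<le> \<Gamma>" using \<Gamma>[OF that(1)] \<Gamma>[OF that(2)] \<gamma>(2)[OF that(1)] \<gamma>(2)[OF that(2)] \<gamma>(1)
      by linarith
    also have "\<dots> = \<Gamma> / \<epsilon> * \<epsilon>" using \<epsilon>(1) by simp
    also have "\<dots> \<le> M * dist x y" using M False \<epsilon>(1) by (intro mult_mono) auto
    finally show ?thesis .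
  qed
  have quad: "\<bar>dist (f x) (f y) - ?g x * dist x y\<bar> \<le> M * (dist x y)\<^sup>2" if "x \<in> V" "y \<in> V" for x y
  proof (cases "dist x y \<le> \<epsilon>")
    case True
    have "\<bar>dist (f x) (f y) - ?g x * dist x y\<bar> \<le> C1 * (dist x y)\<^sup>2" by (rule taylor[OF that True])
    also have "\<dots> \<le> M * (dist x y)\<^sup>2" using M by (intro mult_right_mono) auto
    finally show ?thesis .
  next
    case False
    have "dist (f x) (f y) \<le> c * dist x y" using lip that by (rule lipschitz_onD)
    moreover have "0 \<le> ?g x * dist x y" "?g x * dist x y \<le> \<Gamma> * dist x y" "0 \<le> c * dist x y"
      using \<Gamma>[OF that(1)] \<gamma>(1) \<gamma>(2)[OF that(1)] c0 by (auto intro!: mult_right_mono mult_nonneg_nonneg)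
    ultimately have "\<bar>dist (f x) (f y) - ?g x * dist x y\<bar> \<le> (c + \<Gamma>) * dist x y"
      using zero_le_dist[of "f x" "f y"] unfolding abs_le_iff distrib_right
      by (intro conjI; linarith)
    also have "\<dots> = (c + \<Gamma>) / \<epsilon> * (\<epsilon> * dist x y)" using \<epsilon>(1) by simp
    also have "\<dots> \<le> M * (dist x y * dist x y)"
      using M False \<epsilon>(1) by (intro mult_mono mult_right_mono) auto
    finally show ?thesis by (simp add: power2_eq_square)
  qed
  \<comment> \<open>The lower bound \<gamma> of the derivative turns the Lipschitz bound into one
    for its logarithm, and the absolute quadratic error into a relative one.\<close>
  show ?thesis
  proof (rule that[of "M / \<gamma>"])
    show "0 \<le> M / \<gamma>" using M \<gamma>(1) by simp
    show "0 < ?g x" if "x \<in> V" for x using conf that V(2) by blast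
    have ln_le: "ln (?g x) - ln (?g y) \<le> M / \<gamma> * dist x y" if "x \<in> V" "y \<in> V" for x y
    proof -
      have pos: "0 < ?g x" "0 < ?g y" using conf that V(2) by blast+
      have "ln (?g x) - ln (?g y) \<le> (?g x - ?g y) / ?g y" by (rule ln_diff_le[OF pos])
      also have "\<dots> \<le> \<bar>?g x - ?g y\<bar> / ?g y" using pos by (intro divide_right_mono) auto
      also have "\<dots> \<le> M * dist x y / \<gamma>"
        using g_lip[OF that] \<gamma>(1) \<gamma>(2)[OF that(2)] M by (intro frac_le) auto
      finally show ?thesis by simp
    qed
    show "\<bar>ln (?g x) - ln (?g y)\<bar> \<le> M / \<gamma> * dist x y" if "x \<in> V" "y \<in> V" for x y
      using ln_le[OF that] ln_le[OF that(2,1)] by (simp add: abs_le_iff dist_commute)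
    fix x y assume xy: "x \<in> V" "y \<in> V"
    have "M * (dist x y)\<^sup>2 * 1 \<le> M * (dist x y)\<^sup>2 * (?g x / \<gamma>)"
      using M \<gamma>(1) \<gamma>(2)[OF xy(1)] by (intro mult_left_mono) auto
    then show "\<bar>dist (f x) (f y) - ?g x * dist x y\<bar> \<le> ?g x * (M / \<gamma> * (dist x y)\<^sup>2)"
      using quad[OF xy] by (simp add: mult.commute mult.left_commute)
  qed
qed

section \<open>Bernoulli measures and the coding map\<close>

lemma restrict_UNIV: "restrict f UNIV = f"
  by (simp add: fun_eq_iff)

lemma word_map_eq_foldr: "word_map \<phi> w = foldr \<phi> w"
  unfolding word_map_def by (induction w) auto

lemma words_eq_tuples: "words m q = tuples {1..m} q"
  by (simp add: words_def tuples_def)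

lemma foldr_foldr: "foldr (foldr \<phi>) ws x = foldr \<phi> (concat ws) x"
  by (induction ws) auto

section \<open>Regrouping a sequence into blocks of equal length\<close>

definition blocks :: "nat \<Rightarrow> (nat \<Rightarrow> 'b) \<Rightarrow> nat \<Rightarrow> 'b list" where
  "blocks n x k = map x [k * n..<Suc k * n]"

lemma length_blocks [simp]: "length (blocks n x k) = n"
  by (simp add: blocks_def)

lemma concat_initial_blocks: "concat (initial (blocks n x) N) = initial x (N * n)"
proof (induction N)
  case (Suc N)
  have "initial x (Suc N * n) = map x ([0..<N * n] @ [N * n..<N * n + n])"
    unfolding initial_def by (subst upt_add_eq_append[symmetric]) (auto simp: add.commute)
  then show ?case using Suc by (simp add: initial_Suc blocks_def initial_def add.commute)
qed (simp add: initial_def)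

text \<open>Concatenation is injective on lists of \<open>N\<close> words of length
  \<open>n\<close>. Hence a cylinder in the block alphabet is an ordinary cylinder, from which it
  inherits measurability and mass.\<close>

lemma initial_blocks_eq_iff:
  assumes "bs \<in> tuples (tuples B n) N"
  shows "initial (blocks n x) N = bs \<longleftrightarrow> initial x (N * n) = concat bs"
proof
  assume "initial x (N * n) = concat bs"
  then have "concat (initial (blocks n x) N) = concat bs" by (simp add: concat_initial_blocks)
  moreover have "length a = n" if "a \<in> set (initial (blocks n x) N)" for a
    using that by (auto simp: initial_def)
  ultimately show "initial (blocks n x) N = bs"
    using assms
    by (intro concat_injective) (fastforce simp: tuples_def dest: set_zip_leftD set_zip_rightD)+
qed (auto simp flip: concat_initial_blocks)

lemma concat_tuples: "bs \<in> tuples (tuples B n) N \<Longrightarrow> concat bs \<in> tuples B (N * n)"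
proof (induction N arbitrary: bs)
  case (Suc N)
  then obtain b cs where "bs = b # cs" "b \<in> tuples B n" "cs \<in> tuples (tuples B n) N"
    by (auto simp: tuples_Suc)
  then show ?case using Suc.IH[of cs] by (auto simp: tuples_def)
qed (auto simp: tuples_def)

lemma blocks_in_tuples: "(\<And>k. x k \<in> B) \<Longrightarrow> blocks n x k \<in> tuples B n"
  by (auto simp: blocks_def tuples_def)

lemma prod_list_map_concat: "prod_list (map p (concat bs)) = prod_list (map (\<lambda>b. prod_list (map p b)) bs)"
  by (induction bs) auto

lemma (in prob_space) expectation_finite_valued:
  fixes Y :: "'a \<Rightarrow> 'b" and u :: "'b \<Rightarrow> real"
  assumes "finite B" and "\<And>\<omega>. \<omega> \<in> space M \<Longrightarrow> Y \<omega> \<in> B"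
    and ev: "\<And>b. b \<in> B \<Longrightarrow> {\<omega> \<in> space M. Y \<omega> = b} \<in> events"
    and pr: "\<And>b. b \<in> B \<Longrightarrow> prob {\<omega> \<in> space M. Y \<omega> = b} = P b"
  shows "expectation (\<lambda>\<omega>. u (Y \<omega>)) = (\<Sum>b\<in>B. P b * u b)"
proof -
  have "expectation (\<lambda>\<omega>. u (Y \<omega>))
      = expectation (\<lambda>\<omega>. \<Sum>b\<in>B. u b * indicator {\<omega> \<in> space M. Y \<omega> = b} \<omega>)"
  proof (rule Bochner_Integration.integral_cong[OF refl])
    fix \<omega> assume "\<omega> \<in> space M"
    then have "(\<Sum>b\<in>B. u b * indicator {\<omega> \<in> space M. Y \<omega> = b} \<omega>) = (\<Sum>b\<in>B. if b = Y \<omega> then u b else 0)"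
      by (intro sum.cong) (auto simp: indicator_def)
    then show "u (Y \<omega>) = (\<Sum>b\<in>B. u b * indicator {\<omega> \<in> space M. Y \<omega> = b} \<omega>)"
      using assms \<open>\<omega> \<in> space M\<close> by simp
  qed
  also have "\<dots> = (\<Sum>b\<in>B. expectation (\<lambda>\<omega>. u b * indicator {\<omega> \<in> space M. Y \<omega> = b} \<omega>))"
    using ev by (intro Bochner_Integration.integral_sum integrable_mult_right integrable_real_indicator)
      (auto simp: emeasure_eq_measure)
  also have "\<dots> = (\<Sum>b\<in>B. P b * u b)"
    using ev pr by (intro sum.cong) (auto simp: measure_def[symmetric])
  finally show ?thesis .
qed

section \<open>Finite words and the shift under a Bernoulli measure\<close>

locale bernoulli =
  fixes m :: nat and p :: "nat \<Rightarrow> real"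
  assumes prob_vector: "prob_vector m p"
begin

abbreviation "\<mu> \<equiv> bernoulli_measure m p"

lemma prob_space_letter: "prob_space (point_measure {1..m} (\<lambda>i. ennreal (p i)))"
proof
  have "(\<Sum>i=1..m. ennreal (p i)) = 1"
    using prob_vector by (subst sum_ennreal) (auto simp: prob_vector_def)
  then show "emeasure (point_measure {1..m} (\<lambda>i. ennreal (p i)))
      (space (point_measure {1..m} (\<lambda>i. ennreal (p i)))) = 1"
    by (simp add: space_point_measure emeasure_point_measure_finite)
qed

sublocale prob_space \<mu>
  unfolding bernoulli_measure_def by (intro prob_space_PiM prob_space_letter)

lemma p_nonneg: "i \<in> {1..m} \<Longrightarrow> 0 \<le> p i"
  using prob_vector by (auto simp: prob_vector_def)

lemma sum_p: "sum p {1..m} = 1"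
  using prob_vector by (auto simp: prob_vector_def)

lemma in_letters: "\<omega> \<in> space \<mu> \<Longrightarrow> \<omega> k \<in> {1..m}"
  by (simp add: space_bernoulli_measure)

lemma shift_space: "\<omega> \<in> space \<mu> \<Longrightarrow> \<omega> \<circ> Suc \<in> space \<mu>"
  by (simp add: space_bernoulli_measure)

lemma initial_in: "\<omega> \<in> space \<mu> \<Longrightarrow> initial \<omega> n \<in> tuples {1..m} n"
  using in_letters by (auto simp: tuples_def initial_def)

lemma measurable_coordinate [measurable]: "(\<lambda>\<omega>. \<omega> k) \<in> measurable \<mu> (count_space UNIV)"
proof -
  have "(\<lambda>\<omega>. \<omega> k) \<in> measurable \<mu> (point_measure {1..m} (\<lambda>i. ennreal (p i)))"
    unfolding bernoulli_measure_def by (rule measurable_component_singleton) simp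
  moreover have "(\<lambda>i. i) \<in> measurable (point_measure {1..m} (\<lambda>i. ennreal (p i))) (count_space UNIV)"
    by (auto simp: measurable_def sets_point_measure space_point_measure)
  ultimately show ?thesis by (rule measurable_compose)
qed

lemma measurable_initial [measurable]: "(\<lambda>\<omega>. initial \<omega> n) \<in> measurable \<mu> (count_space UNIV)"
proof (subst measurable_count_space_eq2_countable, intro conjI ballI)
  fix w :: "nat list"
  have "initial \<omega> n = w \<longleftrightarrow> length w = n \<and> (\<forall>k\<in>{..<n}. \<omega> k = w ! k)" for \<omega>
    by (subst list_eq_iff_nth_eq) (auto simp: initial_def)
  then have "(\<lambda>\<omega>. initial \<omega> n) -` {w} \<inter> space \<mu>
      = {\<omega> \<in> space \<mu>. length w = n \<and> (\<forall>k\<in>{..<n}. \<omega> k = w ! k)}"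
    by blast
  also have "\<dots> \<in> sets \<mu>" by measurable
  finally show "(\<lambda>\<omega>. initial \<omega> n) -` {w} \<inter> space \<mu> \<in> sets \<mu>" .
qed simp

lemma measurable_initial_comp [measurable]: "(\<lambda>\<omega>. u (initial \<omega> n)) \<in> borel_measurable \<mu>"
  using measurable_initial by (rule measurable_compose) simp

lemma prob_initial_word:
  assumes "w \<in> tuples {1..m} n"
  shows "prob {\<omega> \<in> space \<mu>. initial \<omega> n = w} = prod_list (map p w)"
proof -
  have "0 \<le> prod_list (map p w)" using assms p_nonneg
    by (intro prod_list_nonneg) (auto simp: tuples_def)
  then show ?thesis
    using emeasure_bernoulli_cylinder[OF prob_vector, of w n] assms
    by (simp add: words_eq_tuples initial_def emeasure_eq_measure)
qed

lemma integrable_initial: "integrable \<mu> (\<lambda>\<omega>. u (initial \<omega> n) :: real)"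
proof (rule integrable_const_bound[where B = "\<Sum>w\<in>tuples {1..m} n. \<bar>u w\<bar>"])
  show "AE \<omega> in \<mu>. norm (u (initial \<omega> n)) \<le> (\<Sum>w\<in>tuples {1..m} n. \<bar>u w\<bar>)"
  proof (rule AE_I2)
    fix \<omega> assume "\<omega> \<in> space \<mu>"
    then show "norm (u (initial \<omega> n)) \<le> (\<Sum>w\<in>tuples {1..m} n. \<bar>u w\<bar>)"
      unfolding real_norm_def using initial_in finite_tuples[of "{1..m}" n]
      by (intro member_le_sum[of "initial \<omega> n" _ "\<lambda>w. \<bar>u w\<bar>"]) auto
  qed
qed measurable

text \<open>The shift reindexes a product of identical factors along the injective map
  \<open>Suc\<close>.\<close>

lemma distr_shift: "distr \<mu> \<mu> (\<lambda>\<omega>. \<omega> \<circ> Suc) = \<mu>"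
proof -
  have "distr \<mu> \<mu> (\<lambda>\<omega>. \<lambda>n\<in>UNIV. \<omega> (Suc n)) = \<mu>"
    unfolding bernoulli_measure_def
    by (rule distr_PiM_reindex[of UNIV "\<lambda>_. point_measure {1..m} (\<lambda>i. ennreal (p i))" Suc UNIV])
      (use prob_space_letter in auto)
  then show ?thesis by (simp add: comp_def restrict_UNIV)
qed

lemma measurable_shift [measurable]: "(\<lambda>\<omega>. \<omega> \<circ> Suc) \<in> measurable \<mu> \<mu>"
proof -
  have "(\<lambda>\<omega>. \<lambda>n\<in>UNIV. \<omega> (Suc n)) \<in> measurable \<mu> \<mu>"
    unfolding bernoulli_measure_def
    by (intro measurable_restrict measurable_component_singleton) auto
  then show ?thesis by (simp add: comp_def restrict_UNIV)
qed

lemma expectation_shift: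
  assumes "u \<in> borel_measurable \<mu>"
  shows "expectation (\<lambda>\<omega>. u (\<omega> \<circ> Suc)) = (expectation u :: real)"
  using integral_distr[OF measurable_shift assms] by (simp add: distr_shift)

end

section \<open>The coding map and the Lyapunov exponent\<close>

locale conformal_bernoulli =
  conformal_system V W "{1..m}" \<phi> g c L + bernoulli m p
  for V W :: "'a::euclidean_space set" and m :: nat and \<phi> g c L p
begin

text \<open>This gives the \<open>THE\<close> in \<open>coding\<close> its meaning: existence by
  nested compact sets, uniqueness because their diameters are at most
  \<open>c ^ n * diameter V\<close>.\<close>

lemma coding_unique_exists:
  assumes "\<omega> \<in> space \<mu>"
  shows "\<exists>!x. x \<in> (\<Inter>n. F (initial \<omega> n) ` V)"
proof -
  have w: "set (initial \<omega> n) \<subseteq> {1..m}" for n using in_letters[OF assms] by (intro set_initial_subset)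
  have "V \<noteq> {}" using W_nonempty W_subset by blast
  have "(\<Inter>n. F (initial \<omega> n) ` V) \<noteq> {}"
  proof (rule compact_nest)
    show "compact (F (initial \<omega> n) ` V)" for n
      using compact_V continuous_F[OF w] by (intro compact_continuous_image)
    show "F (initial \<omega> n) ` V \<noteq> {}" for n using \<open>V \<noteq> {}\<close> by simp
    have "F (initial \<omega> (Suc n)) ` V \<subseteq> F (initial \<omega> n) ` V" for n
      using maps_V[OF in_letters[OF assms, of n]] by (auto simp: initial_Suc)
    then show "k \<le> n \<Longrightarrow> F (initial \<omega> n) ` V \<subseteq> F (initial \<omega> k) ` V" for k n
      by (rule lift_Suc_antimono_le)
  qed
  moreover have "x = y" if xy: "x \<in> (\<Inter>n. F (initial \<omega> n) ` V)" "y \<in> (\<Inter>n. F (initial \<omega> n) ` V)" for x y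
  proof -
    have "dist x y \<le> c ^ n * diameter V" for n
    proof -
      obtain u v where uv: "u \<in> V" "v \<in> V" "x = F (initial \<omega> n) u" "y = F (initial \<omega> n) v"
        using xy by blast
      then have "dist x y \<le> c ^ n * dist u v" using dist_F_le[OF w, of u v n] by simp
      also have "\<dots> \<le> c ^ n * diameter V"
        using c uv diameter_bounded_bound[OF compact_imp_bounded[OF compact_V]] by (intro mult_left_mono) auto
      finally show ?thesis .
    qed
    moreover have "(\<lambda>n. c ^ n * diameter V) \<longlonglongrightarrow> 0 * diameter V"
      using c by (intro tendsto_mult LIMSEQ_power_zero tendsto_const) auto
    ultimately have "dist x y \<le> 0 * diameter V"
      by (intro LIMSEQ_le_const) auto
    then show ?thesis by simp
  qed
  ultimately show ?thesis by blast
qed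

lemma coding_in:
  assumes "\<omega> \<in> space \<mu>"
  shows "coding V \<phi> \<omega> \<in> F (initial \<omega> n) ` V"
proof -
  have "coding V \<phi> \<omega> = (THE x. x \<in> (\<Inter>n. F (initial \<omega> n) ` V))"
    by (simp add: coding_def word_map_eq_foldr initial_def)
  then have "coding V \<phi> \<omega> \<in> (\<Inter>n. F (initial \<omega> n) ` V)"
    using theI'[OF coding_unique_exists[OF assms]] by simp
  then show ?thesis by blast
qed

lemma coding_in_V: "\<omega> \<in> space \<mu> \<Longrightarrow> coding V \<phi> \<omega> \<in> V"
  using coding_in[of \<omega> 0] by (simp add: initial_def)

lemma dist_coding_le:
  assumes "\<omega> \<in> space \<mu>" "x \<in> V"
  shows "dist (coding V \<phi> \<omega>) (F (initial \<omega> n) x) \<le> c ^ n * diameter V"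
proof -
  have w: "set (initial \<omega> n) \<subseteq> {1..m}" using in_letters[OF assms(1)] by (intro set_initial_subset)
  obtain v where v: "v \<in> V" "coding V \<phi> \<omega> = F (initial \<omega> n) v"
    using coding_in[OF assms(1)] by blast
  then have "dist (coding V \<phi> \<omega>) (F (initial \<omega> n) x) \<le> c ^ n * dist v x"
    using dist_F_le[OF w, of v x] assms by simp
  also have "\<dots> \<le> c ^ n * diameter V"
    using c v assms diameter_bounded_bound[OF compact_imp_bounded[OF compact_V]] by (intro mult_left_mono) auto
  finally show ?thesis .
qed

lemma power_diameter_tendsto_0: "(\<lambda>n. c ^ n * diameter V) \<longlonglongrightarrow> 0"
  using tendsto_mult[OF LIMSEQ_power_zero tendsto_const, of c "diameter V"] c by simp

text \<open>The coding map is a pointwise limit of maps that depend on finitely many letters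
  only.\<close>

lemma measurable_coding [measurable]: "coding V \<phi> \<in> borel_measurable \<mu>"
proof -
  obtain x0 where x0: "x0 \<in> V" using W_nonempty W_subset by blast
  show ?thesis
  proof (rule borel_measurable_LIMSEQ_metric[where f = "\<lambda>n \<omega>. F (initial \<omega> n) x0"])
    show "(\<lambda>\<omega>. F (initial \<omega> n) x0) \<in> borel_measurable \<mu>" for n
      using measurable_initial by (rule measurable_compose) simp
    show "(\<lambda>n. F (initial \<omega> n) x0) \<longlonglongrightarrow> coding V \<phi> \<omega>" if "\<omega> \<in> space \<mu>" for \<omega>
      using power_diameter_tendsto_0 dist_coding_le[OF that x0]
      by (intro metric_tendsto_imp_tendsto[OF power_diameter_tendsto_0] always_eventually)
        (auto simp: dist_commute intro: order_trans[OF _ abs_ge_self])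
  qed
qed

text \<open>For \<open>g i = deriv_norm (\<phi> i)\<close> this is the integrand of the Lyapunov
  exponent.\<close>

definition log_deriv :: "(nat \<Rightarrow> nat) \<Rightarrow> real" where
  "log_deriv \<omega> = ln (g (\<omega> 0) (coding V \<phi> (\<omega> \<circ> Suc)))"

lemma log_deriv_approx:
  assumes "\<omega> \<in> space \<mu>" "x \<in> V"
  shows "\<bar>log_deriv \<omega> - ln (g (\<omega> 0) (F (initial (\<omega> \<circ> Suc) n) x))\<bar> \<le> L * (c ^ n * diameter V)"
proof -
  have w: "set (initial (\<omega> \<circ> Suc) n) \<subseteq> {1..m}"
    using in_letters[OF shift_space[OF assms(1)]] by (intro set_initial_subset)
  have "\<bar>log_deriv \<omega> - ln (g (\<omega> 0) (F (initial (\<omega> \<circ> Suc) n) x))\<bar>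
      \<le> L * dist (coding V \<phi> (\<omega> \<circ> Suc)) (F (initial (\<omega> \<circ> Suc) n) x)"
    unfolding log_deriv_def using assms w
    by (intro ln_g_lipschitz in_letters coding_in_V F_in shift_space)
  also have "\<dots> \<le> L * (c ^ n * diameter V)"
    using L dist_coding_le[OF shift_space[OF assms(1)] assms(2)] by (intro mult_left_mono)
  finally show ?thesis .
qed

lemma log_deriv_approx_eq:
  "ln (g (\<omega> 0) (F (initial (\<omega> \<circ> Suc) n) x)) = (\<lambda>w. ln (g (hd w) (F (tl w) x))) (initial \<omega> (Suc n))"
  by (simp add: initial_Suc_Cons)

text \<open>Measurability comes from approximation by functions of finitely many letters;
  integrability, from staying within a bounded distance of a function of the first letter.\<close>

lemma integrable_log_deriv: "integrable \<mu> log_deriv"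
proof -
  obtain x0 where x0: "x0 \<in> V" using W_nonempty W_subset by blast
  let ?u = "\<lambda>n \<omega>. ln (g (\<omega> 0) (F (initial (\<omega> \<circ> Suc) n) x0))"
  have int: "integrable \<mu> (?u n)" for n
    unfolding log_deriv_approx_eq by (rule integrable_initial)
  have meas: "log_deriv \<in> borel_measurable \<mu>"
  proof (rule borel_measurable_LIMSEQ_metric[where f = ?u])
    show "?u n \<in> borel_measurable \<mu>" for n using int by blast
    have "(\<lambda>n. L * (c ^ n * diameter V)) \<longlonglongrightarrow> L * 0"
      by (intro tendsto_mult tendsto_const power_diameter_tendsto_0)
    then have lim: "(\<lambda>n. L * (c ^ n * diameter V)) \<longlonglongrightarrow> 0" by simp
    show "(\<lambda>n. ?u n \<omega>) \<longlonglongrightarrow> log_deriv \<omega>" if "\<omega> \<in> space \<mu>" for \<omega>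
      using log_deriv_approx[OF that x0]
      by (intro metric_tendsto_imp_tendsto[OF lim] always_eventually)
        (auto simp: dist_real_def abs_minus_commute intro: order_trans[OF _ abs_ge_self])
  qed
  have "integrable \<mu> (\<lambda>\<omega>. log_deriv \<omega> - ?u 0 \<omega>)"
    using log_deriv_approx[OF _ x0, of _ 0] meas int[of 0]
    by (intro integrable_const_bound[where B = "L * (c ^ 0 * diameter V)"] AE_I2) auto
  from Bochner_Integration.integrable_add[OF this int[of 0]] show ?thesis by simp
qed

text \<open>Peel off the first letter and use shift invariance for the rest. Replacing the coded
  point by the image of \<open>x\<close> under the next \<open>n\<close> letters costs at most
  \<open>L * c ^ n * diameter V\<close>; these errors are summable, so the total error does not
  depend on \<open>n\<close>.\<close>

lemma expectation_ln_deriv_word_ge: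
  assumes "x \<in> V"
  shows "n * expectation log_deriv - L * diameter V / (1 - c)
    \<le> expectation (\<lambda>\<omega>. ln (deriv_word (initial \<omega> n) x))"
proof -
  have "n * expectation log_deriv - L * diameter V * (\<Sum>j<n. c ^ j)
      \<le> expectation (\<lambda>\<omega>. ln (deriv_word (initial \<omega> n) x))"
  proof (induction n)
    case (Suc n)
    let ?u = "\<lambda>\<omega>. ln (g (\<omega> 0) (F (initial (\<omega> \<circ> Suc) n) x))"
    let ?v = "\<lambda>\<omega>. ln (deriv_word (initial \<omega> n) x)"
    have int_u: "integrable \<mu> ?u" unfolding log_deriv_approx_eq by (rule integrable_initial)
    have int_v: "integrable \<mu> ?v" by (rule integrable_initial)
    have int_v': "integrable \<mu> (\<lambda>\<omega>. ?v (\<omega> \<circ> Suc))"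
      using integrable_distr[OF measurable_shift, of ?v] int_v by (simp add: distr_shift)
    have split: "ln (deriv_word (initial \<omega> (Suc n)) x) = ?u \<omega> + ?v (\<omega> \<circ> Suc)" if "\<omega> \<in> space \<mu>" for \<omega>
    proof -
      have w: "set (initial (\<omega> \<circ> Suc) n) \<subseteq> {1..m}"
        using in_letters[OF shift_space[OF that]] by (intro set_initial_subset)
      show ?thesis
        using g_pos[OF in_letters[OF that, of 0] F_in[OF w assms]] deriv_word_pos[OF w assms]
        by (simp add: initial_Suc_Cons ln_mult)
    qed
    have "expectation (\<lambda>\<omega>. ln (deriv_word (initial \<omega> (Suc n)) x)) = expectation ?u + expectation (\<lambda>\<omega>. ?v (\<omega> \<circ> Suc))"
      using int_u int_v' by (simp add: split cong: Bochner_Integration.integral_cong)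
    also have "expectation (\<lambda>\<omega>. ?v (\<omega> \<circ> Suc)) = expectation ?v"
      using int_v by (intro expectation_shift) blast
    finally have eq: "expectation (\<lambda>\<omega>. ln (deriv_word (initial \<omega> (Suc n)) x)) = expectation ?u + expectation ?v" .
    have "expectation log_deriv \<le> expectation (\<lambda>\<omega>. ?u \<omega> + L * (c ^ n * diameter V))"
    proof (rule integral_mono[OF integrable_log_deriv])
      show "log_deriv \<omega> \<le> ?u \<omega> + L * (c ^ n * diameter V)" if "\<omega> \<in> space \<mu>" for \<omega>
        using log_deriv_approx[OF that assms, of n] by linarith
    qed (use int_u in auto)
    also have "\<dots> = expectation ?u + L * (c ^ n * diameter V)"
      using int_u by (simp add: prob_space)
    finally show ?case using Suc eq by (simp add: algebra_simps)
  qed (simp add: initial_def)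
  moreover have "L * diameter V * (\<Sum>j<n. c ^ j) \<le> L * diameter V * (1 / (1 - c))"
    using L compact_imp_bounded[OF compact_V] sum_power_c_le
    by (intro mult_left_mono mult_nonneg_nonneg diameter_ge_0)
  ultimately show ?thesis unfolding times_divide_eq_right mult_1_right by linarith
qed

end

section \<open>The dimension bound\<close>

text \<open>Only an inequality, because probabilities may vanish: a zero factor makes the left side
  0, while the right side is positive whatever value \<open>ln 0\<close> has.\<close>

lemma prod_list_le_exp_sum_ln:
  fixes p :: "'b \<Rightarrow> real"
  assumes "\<And>i. i \<in> set w \<Longrightarrow> 0 \<le> p i"
  shows "prod_list (map p w) \<le> exp (\<Sum>i\<leftarrow>w. ln (p i))"
  using assms
proof (induction w)
  case (Cons i w)
  have "p i \<le> exp (ln (p i))"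
    using Cons.prems[of i] by (cases "p i = 0") auto
  then have "p i * prod_list (map p w) \<le> exp (ln (p i)) * exp (\<Sum>i\<leftarrow>w. ln (p i))"
    using Cons by (intro mult_mono prod_list_nonneg) auto
  then show ?case by (simp add: exp_add)
qed simp

text \<open>Two cylinders whose images share a point lie in the same cell, so a point meets at most
  \<open>card C\<close> images, all of them of weight \<open>1 / card C\<close>.\<close>

lemma partition_overlap_le_1:
  fixes f :: "'b \<Rightarrow> 'a \<Rightarrow> 'a" and mult :: "'b \<Rightarrow> real"
  assumes "finite B" and part: "partition_on B \<C>"
    and disj: "\<And>C C' w w'. C \<in> \<C> \<Longrightarrow> C' \<in> \<C> \<Longrightarrow> C \<noteq> C' \<Longrightarrow> w \<in> C \<Longrightarrow> w' \<in> C' \<Longrightarrow>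
      f w ` W \<inter> f w' ` W = {}"
    and mult: "\<And>C w. C \<in> \<C> \<Longrightarrow> w \<in> C \<Longrightarrow> mult w = real (card C)"
  shows "(\<Sum>w\<in>B. indicator (f w ` W) y / mult w) \<le> 1"
proof (cases "\<exists>w\<in>B. y \<in> f w ` W")
  case True
  then obtain w where w: "w \<in> B" "y \<in> f w ` W" by blast
  then obtain C where C: "C \<in> \<C>" "w \<in> C" "C \<subseteq> B"
    using part unfolding partition_on_def by blast
  have zero: "y \<notin> f w' ` W" if w': "w' \<in> B - C" for w'
  proof -
    obtain C' where "C' \<in> \<C>" "w' \<in> C'" using w' part unfolding partition_on_def by blast
    then show ?thesis using disj[OF C(1) \<open>C' \<in> \<C>\<close> _ C(2) \<open>w' \<in> C'\<close>] w(2) w' by blast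
  qed
  have "(\<Sum>w\<in>B. indicator (f w ` W) y / mult w) = (\<Sum>w\<in>C. indicator (f w ` W) y / mult w)"
    using zero C(3) \<open>finite B\<close> by (intro sum.mono_neutral_right) auto
  also have "\<dots> \<le> (\<Sum>w\<in>C. 1 / real (card C))"
    using mult[OF C(1)] by (intro sum_mono) (simp add: indicator_def)
  also have "\<dots> \<le> 1" by simp
  finally show ?thesis .
qed (simp add: indicator_def)

lemma exists_uniform_conformal_system:
  fixes V W :: "'a::euclidean_space set"
  assumes "compact V" "open W" "W \<noteq> {}" "W \<subseteq> V"
    and conf: "\<And>i. i \<in> {1..m::nat} \<Longrightarrow> conformal_contraction V (\<phi> i)"
    and "\<And>i. i \<in> {1..m} \<Longrightarrow> \<phi> i ` W \<subseteq> W"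
  obtains c L where "conformal_system V W {1..m} \<phi> (\<lambda>i. deriv_norm (\<phi> i)) c L"
proof -
  define ok where "ok i c L \<longleftrightarrow> c < 1 \<and> c-lipschitz_on V (\<phi> i) \<and> 0 \<le> L \<and>
      (\<forall>x\<in>V. 0 < deriv_norm (\<phi> i) x) \<and>
      (\<forall>x\<in>V. \<forall>y\<in>V. \<bar>ln (deriv_norm (\<phi> i) x) - ln (deriv_norm (\<phi> i) y)\<bar> \<le> L * dist x y) \<and>
      (\<forall>x\<in>V. \<forall>y\<in>V. \<bar>dist (\<phi> i x) (\<phi> i y) - deriv_norm (\<phi> i) x * dist x y\<bar>
        \<le> deriv_norm (\<phi> i) x * (L * (dist x y)\<^sup>2))" for i c L
  have "\<exists>c L. ok i c L" if i: "i \<in> {1..m}" for i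
  proof -
    obtain c U where c: "c < 1" "c-lipschitz_on V (\<phi> i)"
      and U: "open U" "V \<subseteq> U" "smooth_on U (\<phi> i)" "conformal_on U (\<phi> i)"
      using conf[OF i] unfolding conformal_contraction_def by blast
    obtain L where "0 \<le> L"
      "\<And>x. x \<in> V \<Longrightarrow> 0 < deriv_norm (\<phi> i) x"
      "\<And>x y. x \<in> V \<Longrightarrow> y \<in> V \<Longrightarrow> \<bar>ln (deriv_norm (\<phi> i) x) - ln (deriv_norm (\<phi> i) y)\<bar> \<le> L * dist x y"
      "\<And>x y. x \<in> V \<Longrightarrow> y \<in> V \<Longrightarrow> \<bar>dist (\<phi> i x) (\<phi> i y) - deriv_norm (\<phi> i) x * dist x y\<bar>
        \<le> deriv_norm (\<phi> i) x * (L * (dist x y)\<^sup>2)"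
      using C2_bounds[OF \<open>compact V\<close> U(2,1,3,4) c(2)] by blast
    then have "ok i c L" unfolding ok_def using c by blast
    then show ?thesis by blast
  qed
  then obtain c L where ok: "\<And>i. i \<in> {1..m} \<Longrightarrow> ok i (c i) (L i)" by metis
  have c: "\<And>i. i \<in> {1..m} \<Longrightarrow> c i < 1" "\<And>i. i \<in> {1..m} \<Longrightarrow> (c i)-lipschitz_on V (\<phi> i)"
    and L: "\<And>i. i \<in> {1..m} \<Longrightarrow> 0 \<le> L i"
    and pos: "\<And>i x. i \<in> {1..m} \<Longrightarrow> x \<in> V \<Longrightarrow> 0 < deriv_norm (\<phi> i) x"
    and ln: "\<And>i x y. i \<in> {1..m} \<Longrightarrow> x \<in> V \<Longrightarrow> y \<in> V \<Longrightarrow>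
        \<bar>ln (deriv_norm (\<phi> i) x) - ln (deriv_norm (\<phi> i) y)\<bar> \<le> L i * dist x y"
    and quad: "\<And>i x y. i \<in> {1..m} \<Longrightarrow> x \<in> V \<Longrightarrow> y \<in> V \<Longrightarrow>
        \<bar>dist (\<phi> i x) (\<phi> i y) - deriv_norm (\<phi> i) x * dist x y\<bar>
        \<le> deriv_norm (\<phi> i) x * (L i * (dist x y)\<^sup>2)"
    using ok unfolding ok_def by blast+
  \<comment> \<open>The extra element \<open>1 / 2\<close> makes the set nonempty and the common
    rate positive at no cost.\<close>
  define c' where "c' = Max ({1 / 2} \<union> c ` {1..m})"
  have c': "1 / 2 \<le> c'" "\<And>i. i \<in> {1..m} \<Longrightarrow> c i \<le> c'"
    unfolding c'_def by (intro Max_ge; simp)+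
  have c'_less: "c' < 1"
    unfolding c'_def using c(1) by (subst Max_less_iff) auto
  define L' where "L' = sum L {1..m}"
  have L': "0 \<le> L'" "\<And>i. i \<in> {1..m} \<Longrightarrow> L i \<le> L'"
    using L unfolding L'_def by (auto intro!: sum_nonneg member_le_sum)
  show ?thesis
  proof (rule that, unfold_locales)
    fix i assume i: "i \<in> {1..m}"
    show "\<phi> i ` V \<subseteq> V" "inj_on (\<phi> i) V"
      using conf[OF i] unfolding conformal_contraction_def by blast+
    fix x y assume xy: "x \<in> V" "y \<in> V"
    have "dist (\<phi> i x) (\<phi> i y) \<le> c i * dist x y" using c(2)[OF i] xy by (rule lipschitz_onD)
    also have "\<dots> \<le> c' * dist x y" using c'(2)[OF i] by (intro mult_right_mono) auto
    finally show "dist (\<phi> i x) (\<phi> i y) \<le> c' * dist x y" .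
    show "\<bar>ln (deriv_norm (\<phi> i) x) - ln (deriv_norm (\<phi> i) y)\<bar> \<le> L' * dist x y"
      using ln[OF i xy] mult_right_mono[OF L'(2)[OF i] zero_le_dist, of x y] by linarith
    have "deriv_norm (\<phi> i) x * (L i * (dist x y)\<^sup>2) \<le> deriv_norm (\<phi> i) x * (L' * (dist x y)\<^sup>2)"
      using pos[OF i xy(1)] L'(2)[OF i] by (intro mult_left_mono mult_right_mono) auto
    then show "\<bar>dist (\<phi> i x) (\<phi> i y) - deriv_norm (\<phi> i) x * dist x y\<bar>
        \<le> deriv_norm (\<phi> i) x * (L' * (dist x y)\<^sup>2)"
      using quad[OF i xy] by linarith
  qed (use assms c' c'_less L' pos in auto)
qed

section \<open>From long blocks to positive Hausdorff measure\<close>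

context conformal_bernoulli
begin

text \<open>The hypothesis \<open>entropy\<close> says that \<open>t\<close> is below the claimed
  quotient, cleared of its denominator so that no sign of the exponent is needed. The coded measure
  is instantiated with blocks of \<open>n\<close> words of length \<open>q\<close> as
  letters.\<close>

lemma hausdorff_measure_neq_0_of_overlap:
  fixes mult :: "nat list \<Rightarrow> real"
  assumes "0 < q"
    and mult: "\<And>w. w \<in> tuples {1..m} q \<Longrightarrow> 0 < mult w"
    and overlap: "\<And>y. (\<Sum>w\<in>tuples {1..m} q. indicator (F w ` W) y / mult w) \<le> 1"
    and t: "0 \<le> t"
    and entropy: "(\<Sum>i=1..m. p i * ln (p i))
      + 1 / q * (\<Sum>w\<in>tuples {1..m} q. prod_list (map p w) * ln (mult w)) < t * expectation log_deriv"
    and A: "A \<in> sets borel" "AE \<omega> in \<mu>. coding V \<phi> \<omega> \<in> A"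
  shows "hausdorff_measure t A \<noteq> 0"
proof -
  obtain x0 K where x0: "x0 \<in> W" and K: "1 \<le> K"
    and dist: "\<And>w x y. set w \<subseteq> {1..m} \<Longrightarrow> x \<in> V \<Longrightarrow> y \<in> V \<Longrightarrow> deriv_word w x \<le> K * deriv_word w y"
    and diam: "\<And>w x y. set w \<subseteq> {1..m} \<Longrightarrow> x \<in> V \<Longrightarrow> y \<in> V \<Longrightarrow> dist (F w x) (F w y) \<le> K * deriv_word w x0"
    and ball: "\<And>w. set w \<subseteq> {1..m} \<Longrightarrow> ball (F w x0) (deriv_word w x0 / K) \<subseteq> F w ` W"
    and small: "\<And>w. set w \<subseteq> {1..m} \<Longrightarrow> deriv_word w x0 \<le> K * c ^ length w"
    using uniform_geometry by blast
  define D where "D w = deriv_word w x0" for w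
  have x0V: "x0 \<in> V" using x0 W_subset by blast
  have D_pos: "0 < D w" if "set w \<subseteq> {1..m}" for w
    unfolding D_def using that x0V by (rule deriv_word_pos)
  have D_append: "D u * D v / K \<le> D (u @ v)" if "set u \<subseteq> {1..m}" "set v \<subseteq> {1..m}" for u v
  proof -
    have "D u \<le> K * deriv_word u (F v x0)"
      unfolding D_def using that x0V F_in by (intro dist) auto
    then have "D u * D v \<le> K * deriv_word u (F v x0) * D v"
      using D_pos[OF that(2)] by (intro mult_right_mono) auto
    then show ?thesis using K by (simp add: D_def deriv_word_append field_simps)
  qed

  define h where "h = (\<Sum>i=1..m. p i * ln (p i))
      + 1 / q * (\<Sum>w\<in>tuples {1..m} q. prod_list (map p w) * ln (mult w))"
  define lyap where "lyap = expectation log_deriv"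
  \<comment> \<open>The loss per block: the first summand is the error in comparing the mean of
    \<open>ln D\<close> with the Lyapunov exponent, and \<open>ln K\<close> comes from the division
    by \<open>K\<close> in \<open>a\<close>.\<close>
  define C where "C = L * diameter V / (1 - c) + ln K"
  have gap: "0 < q * (t * lyap - h)" using entropy \<open>0 < q\<close> by (simp add: h_def lyap_def)
  obtain n0 :: nat where n0: "t * C < n0 * (q * (t * lyap - h))"
    using reals_Archimedean3[OF gap] by blast
  \<comment> \<open>The successor makes blocks nonempty, so that each of them contracts at least by
    \<open>c\<close>.\<close>
  define n where "n = Suc n0"
  have "n0 * (q * (t * lyap - h)) \<le> n * (q * (t * lyap - h))"
    using gap by (intro mult_right_mono) (auto simp: n_def)
  with n0 have n: "t * C < n * (q * (t * lyap - h))" by linarith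

  define Q where "Q = tuples {1..m} q"
  define B where "B = tuples Q n"
  define pw where "pw w = prod_list (map p w)" for w
  define P where "P b = prod_list (map pw b)" for b
  define M where "M b = prod_list (map mult b)" for b
  \<comment> \<open>\<open>D\<close> is supermultiplicative only up to the factor
    \<open>1 / K\<close>; dividing every block size by \<open>K\<close> turns their product into a
    true lower bound.\<close>
  define a where "a b = D (concat b) / K" for b
  define DD where "DD bs = D (concat (concat bs))" for bs
  define X where "X \<omega> = blocks n (blocks q \<omega>)" for \<omega> :: "nat \<Rightarrow> nat"
  \<comment> \<open>The logarithm of \<open>P b * M b / a b powr t\<close>, with
    \<open>ln (P b)\<close> written as a sum over letters so that its mean can be computed even if
    some probabilities vanish.\<close>
  define \<xi> where "\<xi> b = (\<Sum>w\<leftarrow>b. (\<Sum>i\<leftarrow>w. ln (p i)) + ln (mult w)) - t * ln (a b)" for b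
  have fin: "finite Q" "finite B" unfolding Q_def B_def by (intro finite_tuples; simp)+
  have flat: "set (concat (concat bs)) \<subseteq> {1..m}" if "set bs \<subseteq> B" for bs
    using that unfolding B_def Q_def tuples_def by fastforce
  have flat1: "set (concat b) \<subseteq> {1..m}" if "b \<in> B" for b
    using flat[of "[b]"] that by simp
  have a_pos: "0 < a b" if "b \<in> B" for b
    using D_pos[OF flat1[OF that]] K by (simp add: a_def)
  have pw_nonneg: "0 \<le> pw w" if "w \<in> Q" for w
    unfolding pw_def using that p_nonneg by (intro prod_list_nonneg) (auto simp: Q_def tuples_def)
  have P_nonneg: "0 \<le> P b" if "b \<in> B" for b
    unfolding P_def using that pw_nonneg by (intro prod_list_nonneg) (auto simp: B_def tuples_def)
  have sum_pw: "sum pw Q = 1"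
    unfolding pw_def Q_def sum_tuples_prod_list[OF finite_atLeastAtMost] sum_p by simp
  have sum_P: "sum P B = 1"
    unfolding P_def B_def by (simp add: sum_tuples_prod_list fin sum_pw)
  have X_in: "X \<omega> k \<in> B" if "\<omega> \<in> space \<mu>" for \<omega> k
    unfolding X_def B_def Q_def using in_letters[OF that] by (intro blocks_in_tuples)
  \<comment> \<open>Both levels of grouping are undone: \<open>N\<close> blocks of \<open>n\<close>
    words of \<open>q\<close> letters cover the first \<open>N * n * q\<close> letters.\<close>
  have X_iff: "initial (X \<omega>) N = bs \<longleftrightarrow> initial \<omega> (N * n * q) = concat (concat bs)"
    if "bs \<in> tuples B N" for \<omega> bs N
    using that initial_blocks_eq_iff[of bs Q n N "blocks q \<omega>"]
      initial_blocks_eq_iff[OF concat_tuples[of bs Q n N, unfolded Q_def], of \<omega>]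
    by (simp add: X_def B_def Q_def)
  have cylinder: "{\<omega> \<in> space \<mu>. initial (X \<omega>) (length bs) = bs} \<in> events"
    and prob_cylinder: "prob {\<omega> \<in> space \<mu>. initial (X \<omega>) (length bs) = bs} = prod_list (map P bs)"
    if "set bs \<subseteq> B" for bs
  proof -
    have bs: "bs \<in> tuples B (length bs)" using that by (simp add: tuples_def)
    have eq: "{\<omega> \<in> space \<mu>. initial (X \<omega>) (length bs) = bs}
        = {\<omega> \<in> space \<mu>. initial \<omega> (length bs * n * q) = concat (concat bs)}"
      using X_iff[OF bs] by simp
    show "{\<omega> \<in> space \<mu>. initial (X \<omega>) (length bs) = bs} \<in> events"
      unfolding eq by measurable
    have "concat (concat bs) \<in> tuples {1..m} (length bs * n * q)"
      using bs by (intro concat_tuples) (simp add: B_def Q_def)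
    then have "prob {\<omega> \<in> space \<mu>. initial (X \<omega>) (length bs) = bs} = prod_list (map p (concat (concat bs)))"
      unfolding eq by (rule prob_initial_word)
    then show "prob {\<omega> \<in> space \<mu>. initial (X \<omega>) (length bs) = bs} = prod_list (map P bs)"
      by (simp add: prod_list_map_concat P_def[abs_def] pw_def[abs_def])
  qed

  \<comment> \<open>Finitely many blocks have a smallest size. Appending a block then loses at most
    the factor \<open>K / \<kappa>\<close>, and \<kappa> \<le> 1 keeps this constant at least
    \<open>K\<close>.\<close>
  have "\<exists>\<kappa>>0. \<kappa> \<le> 1 \<and> (\<forall>b\<in>B. \<kappa> \<le> D (concat b))"
    using D_pos flat1 fin(2)
    by (intro exI[of _ "Min (insert 1 ((D \<circ> concat) ` B))"]) auto
  then obtain \<kappa> where \<kappa>: "0 < \<kappa>" "\<kappa> \<le> 1" "\<And>b. b \<in> B \<Longrightarrow> \<kappa> \<le> D (concat b)" by blast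
  define K' where "K' = K / \<kappa>"
  have K': "1 \<le> K'" "K \<le> K'" using K \<kappa> by (auto simp: K'_def field_simps intro: order_trans)

  have F_eq: "foldr (\<lambda>b. foldr F b) bs = F (concat (concat bs))" for bs
    by (simp add: fun_eq_iff foldr_foldr)
  interpret coded: coded_measure \<mu> X "coding V \<phi>" B P M a "\<lambda>b. foldr F b" V W DD K' c
  proof unfold_locales
    show "finite B" by (rule fin)
    show "X \<omega> k \<in> B" if "\<omega> \<in> space \<mu>" for \<omega> k by (rule X_in[OF that])
    show "{\<omega> \<in> space \<mu>. initial (X \<omega>) (length bs) = bs} \<in> events"
      "prob {\<omega> \<in> space \<mu>. initial (X \<omega>) (length bs) = bs} = prod_list (map P bs)"
      if "set bs \<subseteq> B" for bs by (rule cylinder[OF that] prob_cylinder[OF that])+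
    show "0 \<le> P b" if "b \<in> B" for b by (rule P_nonneg[OF that])
    show "sum P B = 1" by (rule sum_P)
    show "coding V \<phi> \<in> borel_measurable \<mu>" by (rule measurable_coding)
    show "coding V \<phi> \<omega> \<in> foldr (\<lambda>b. foldr F b) (initial (X \<omega>) N) ` V" if "\<omega> \<in> space \<mu>" for \<omega> N
      unfolding F_eq X_def concat_initial_blocks using that by (rule coding_in)
    show "W \<subseteq> V" by (rule W_subset)
    show "foldr F b ` W \<subseteq> W" "inj_on (foldr F b) W" if "b \<in> B" for b
    proof -
      have eq: "foldr F b = F (concat b)" by (simp add: fun_eq_iff foldr_foldr)
      show "foldr F b ` W \<subseteq> W"
        unfolding eq by (rule foldr_image_subset[OF maps_W flat1[OF that]])
      show "inj_on (foldr F b) W"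
        unfolding eq by (rule inj_on_subset[OF inj_F[OF flat1[OF that]] W_subset])
    qed
    show "0 < M b" if "b \<in> B" for b
    proof -
      have "set b \<subseteq> Q" using that by (simp add: B_def tuples_def)
      then show ?thesis unfolding M_def
        by (induction b) (auto intro!: mult_pos_pos mult simp: Q_def)
    qed
    show "(\<Sum>b\<in>B. indicator (foldr F b ` W) y / M b) \<le> 1" for y
      unfolding M_def B_def
    \<comment> \<open>Words of one fixed length are prefix-free, so the overlap bound passes from
      words of length \<open>q\<close> to blocks.\<close>
    proof (rule sum_prefix_free_le_1[of Q])
      show "F w ` W \<subseteq> W" if "w \<in> Q" for w
        using that by (intro foldr_image_subset[of "{1..m}" \<phi> W w, OF maps_W]) (auto simp: Q_def tuples_def)
      show "inj_on (F w) W" if "w \<in> Q" for w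
        using that by (intro inj_on_subset[OF inj_F W_subset]) (auto simp: Q_def tuples_def)
      show "(\<Sum>b\<in>Q. indicator (F b ` W) y / mult b) \<le> 1" for y
        unfolding Q_def by (rule overlap)
      show "0 < mult w" if "w \<in> Q" for w using that mult by (simp add: Q_def)
      show "finite Q" "finite (tuples Q n)" using fin finite_tuples by auto
      show "set b \<subseteq> Q" if "b \<in> tuples Q n" for b using that by (simp add: tuples_def)
      show "prefix_free (tuples Q n)" by (rule prefix_free_tuples)
    qed
    show "1 \<le> K'" by (rule K')
    show "0 < c" "c < 1" by (rule c)+
    show "DD [] = 1" by (simp add: DD_def D_def)
    show "DD bs / K' \<le> DD (bs @ [b])" if "set bs \<subseteq> B" "b \<in> B" for bs b
    proof -
      have "DD bs / K' = DD bs * \<kappa> / K" by (simp add: K'_def)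
      also have "\<dots> \<le> DD bs * D (concat b) / K"
        using \<kappa>(3)[OF that(2)] K D_pos[OF flat[OF that(1)]]
        by (intro divide_right_mono mult_left_mono) (auto simp: DD_def)
      also have "\<dots> \<le> DD (bs @ [b])"
        unfolding DD_def using D_append[OF flat[OF that(1)] flat1[OF that(2)]] by simp
      finally show ?thesis .
    qed
    show "DD bs \<le> K' * c ^ length bs" if "set bs \<subseteq> B" for bs
    proof -
      have "concat (concat bs) \<in> tuples {1..m} (length bs * n * q)"
        using that by (intro concat_tuples) (simp add: B_def Q_def tuples_def)
      then have "length (concat (concat bs)) = length bs * n * q" by (simp add: tuples_def)
      moreover have "length bs * 1 \<le> length bs * (n * q)"
        using \<open>0 < q\<close> by (intro mult_le_mono) (auto simp: n_def)
      ultimately have "c ^ length (concat (concat bs)) \<le> c ^ length bs"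
        using c by (intro power_decreasing) (auto simp: mult.assoc)
      then have "K * c ^ length (concat (concat bs)) \<le> K' * c ^ length bs"
        using K' K c by (intro mult_mono) auto
      then show ?thesis using small[OF flat[OF that]] by (simp add: DD_def D_def)
    qed
    show "dist (foldr (\<lambda>b. foldr F b) bs x) (foldr (\<lambda>b. foldr F b) bs y) \<le> K' * DD bs"
      if "set bs \<subseteq> B" "x \<in> V" "y \<in> V" for bs x y
    proof -
      have "K * DD bs \<le> K' * DD bs"
        using K' D_pos[OF flat[OF that(1)]] by (intro mult_right_mono) (auto simp: DD_def)
      then show ?thesis
        unfolding F_eq using diam[OF flat[OF that(1)] that(2,3)] by (simp add: DD_def D_def)
    qed
    show "\<exists>z. ball z (DD bs / K') \<subseteq> foldr (\<lambda>b. foldr F b) bs ` W" if "set bs \<subseteq> B" for bs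
    proof -
      have "DD bs / K' \<le> DD bs / K"
        using K K' D_pos[OF flat[OF that]] by (intro divide_left_mono) (auto simp: DD_def)
      then have "ball (F (concat (concat bs)) x0) (DD bs / K') \<subseteq> F (concat (concat bs)) ` W"
        using ball[OF flat[OF that]] subset_ball unfolding DD_def D_def by blast
      then show ?thesis unfolding F_eq by blast
    qed
    show "0 < a b" if "b \<in> B" for b by (rule a_pos[OF that])
    show "prod_list (map a bs) \<le> DD bs" if "set bs \<subseteq> B" for bs
      using that
    proof (induction bs)
      case (Cons b bs)
      then have "a b * prod_list (map a bs) \<le> a b * DD bs"
        using a_pos[of b] by (intro mult_left_mono) auto
      also have "\<dots> = D (concat b) * D (concat (concat bs)) / K" by (simp add: a_def DD_def)
      also have "\<dots> \<le> DD (b # bs)"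
        using D_append[OF flat1 flat, of b bs] Cons.prems by (simp add: DD_def)
      finally show ?case by simp
    qed (simp add: DD_def D_def)
  qed

  show ?thesis
  proof (rule coded.hausdorff_measure_neq_0[of \<xi> t A])
    show "P b * M b \<le> a b powr t * exp (\<xi> b)" if "b \<in> B" for b
    proof -
      have "set b \<subseteq> Q" using that by (simp add: B_def tuples_def)
      then have "P b * M b \<le> exp (\<Sum>w\<leftarrow>b. (\<Sum>i\<leftarrow>w. ln (p i)) + ln (mult w)) \<and> 0 \<le> P b \<and> 0 \<le> M b"
        unfolding P_def M_def
      proof (induction b)
        case (Cons w b)
        then have w: "w \<in> Q" by simp
        have "pw w \<le> exp (\<Sum>i\<leftarrow>w. ln (p i))"
          unfolding pw_def using w p_nonneg
          by (intro prod_list_le_exp_sum_ln) (auto simp: Q_def tuples_def)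
        then have "pw w * mult w \<le> exp (\<Sum>i\<leftarrow>w. ln (p i)) * mult w"
          using mult[of w] w by (intro mult_right_mono) (auto simp: Q_def)
        also have "\<dots> = exp ((\<Sum>i\<leftarrow>w. ln (p i)) + ln (mult w))"
          using mult[of w] w by (simp add: exp_add Q_def)
        finally have "(pw w * mult w) * (prod_list (map pw b) * prod_list (map mult b))
          \<le> exp ((\<Sum>i\<leftarrow>w. ln (p i)) + ln (mult w)) * exp (\<Sum>w\<leftarrow>b. (\<Sum>i\<leftarrow>w. ln (p i)) + ln (mult w))"
          using Cons by (intro mult_mono) auto
        then show ?case
          using Cons pw_nonneg[OF w] mult[of w] w
          by (auto simp: exp_add algebra_simps Q_def)
      qed simp
      moreover have "a b powr t * exp (\<xi> b) = exp (\<Sum>w\<leftarrow>b. (\<Sum>i\<leftarrow>w. ln (p i)) + ln (mult w))"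
        using a_pos[OF that] by (simp add: \<xi>_def powr_def flip: exp_add)
      ultimately show ?thesis by simp
    qed
    have entropy_sum: "(\<Sum>b\<in>B. P b * (\<Sum>w\<leftarrow>b. (\<Sum>i\<leftarrow>w. ln (p i)) + ln (mult w))) = n * (q * h)"
    proof -
      have "(\<Sum>b\<in>B. P b * (\<Sum>w\<leftarrow>b. (\<Sum>i\<leftarrow>w. ln (p i)) + ln (mult w)))
          = n * (\<Sum>w\<in>Q. pw w * ((\<Sum>i\<leftarrow>w. ln (p i)) + ln (mult w)))"
        unfolding P_def B_def by (rule sum_tuples_prod_list_sum_list[OF fin(1) sum_pw])
      also have "(\<Sum>w\<in>Q. pw w * ((\<Sum>i\<leftarrow>w. ln (p i)) + ln (mult w)))
          = q * (\<Sum>i=1..m. p i * ln (p i)) + (\<Sum>w\<in>Q. pw w * ln (mult w))"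
        using sum_tuples_prod_list_sum_list[OF finite_atLeastAtMost sum_p, where n = q and u = "\<lambda>i. ln (p i)"]
        by (simp add: pw_def Q_def distrib_left sum.distrib)
      also have "\<dots> = q * h" using \<open>0 < q\<close> by (simp add: h_def pw_def Q_def distrib_left)
      finally show ?thesis .
    qed
    \<comment> \<open>The first block has law \<open>P\<close> and spells the first
      \<open>n * q\<close> letters, so this finite mean is an expectation to which the Lyapunov
      estimate applies.\<close>
    have "(\<Sum>b\<in>B. P b * ln (D (concat b))) = expectation (\<lambda>\<omega>. ln (D (concat (X \<omega> 0))))"
    proof (rule expectation_finite_valued[symmetric])
      fix b assume "b \<in> B"
      then show "{\<omega> \<in> space \<mu>. X \<omega> 0 = b} \<in> events" "prob {\<omega> \<in> space \<mu>. X \<omega> 0 = b} = P b"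
        using cylinder[of "[b]"] prob_cylinder[of "[b]"] by (simp_all add: initial_def)
    qed (use fin X_in in auto)
    also have "(\<lambda>\<omega>. ln (D (concat (X \<omega> 0)))) = (\<lambda>\<omega>. ln (deriv_word (initial \<omega> (n * q)) x0))"
    proof
      fix \<omega>
      have "X \<omega> 0 = initial (blocks q \<omega>) n" by (simp add: X_def blocks_def initial_def)
      then show "ln (D (concat (X \<omega> 0))) = ln (deriv_word (initial \<omega> (n * q)) x0)"
        by (simp add: D_def concat_initial_blocks)
    qed
    finally have "n * q * lyap - L * diameter V / (1 - c) \<le> (\<Sum>b\<in>B. P b * ln (D (concat b)))"
      using expectation_ln_deriv_word_ge[OF x0V, of "n * q"] by (simp add: lyap_def)
    moreover have "(\<Sum>b\<in>B. P b * ln (a b)) = (\<Sum>b\<in>B. P b * ln (D (concat b))) - ln K"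
    proof -
      have "(\<Sum>b\<in>B. P b * ln (a b)) = (\<Sum>b\<in>B. P b * ln (D (concat b)) - P b * ln K)"
      proof (rule sum.cong[OF refl])
        fix b assume "b \<in> B"
        then show "P b * ln (a b) = P b * ln (D (concat b)) - P b * ln K"
          using D_pos[OF flat1, of b] K by (simp add: a_def ln_div right_diff_distrib)
      qed
      then show ?thesis using sum_P by (simp add: sum_subtractf flip: sum_distrib_right)
    qed
    ultimately have "n * q * lyap - C \<le> (\<Sum>b\<in>B. P b * ln (a b))" by (simp add: C_def)
    then have "t * (n * q * lyap - C) \<le> t * (\<Sum>b\<in>B. P b * ln (a b))"
      using t by (rule mult_left_mono)
    moreover have "(\<Sum>b\<in>B. P b * \<xi> b) = n * (q * h) - t * (\<Sum>b\<in>B. P b * ln (a b))"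
      unfolding entropy_sum[symmetric] \<xi>_def
      by (simp add: right_diff_distrib sum_subtractf sum_distrib_left mult.left_commute)
    ultimately show "(\<Sum>b\<in>B. P b * \<xi> b) < 0"
      using n by (simp add: algebra_simps)
  qed (use t A in auto)
qed

end

theorem corollary3:
  fixes V W :: "'a::euclidean_space set"
    and \<phi> :: "nat \<Rightarrow> 'a \<Rightarrow> 'a"
    and m q s :: nat
    and G :: "nat \<Rightarrow> nat list set"
    and p :: "nat \<Rightarrow> real"
  assumes "compact V" and "interior V \<noteq> {}"
    and "\<forall>i\<in>{1..m}. conformal_contraction V (\<phi> i)"
    and "q \<ge> 1"
    and "open W" and "W \<noteq> {}" and "W \<subseteq> V"
    and "\<forall>i\<in>{1..m}. \<phi> i ` W \<subseteq> W"
    and "partition_on (words m q) (G ` {1..s})" and "inj_on G {1..s}"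
    and "\<forall>i\<in>{1..s}. \<forall>j\<in>{1..s}. i \<noteq> j \<longrightarrow>
           (\<forall>w\<in>G i. \<forall>w'\<in>G j. word_map \<phi> w ` W \<inter> word_map \<phi> w' ` W = {})"
    and "prob_vector m p"
  shows "HD (self_conformal_measure V \<phi> m p) \<ge>
           ereal ((- (\<Sum>i=1..m. p i * ln (p i))
                   - 1 / real q * (\<Sum>i=1..s. ln (real (card (G i))) * (\<Sum>w\<in>G i. prod_list (map p w))))
                  / \<bar>lyapunov V \<phi> (bernoulli_measure m p)\<bar>)"
proof -
  obtain c L where "conformal_system V W {1..m} \<phi> (\<lambda>i. deriv_norm (\<phi> i)) c L"
    using exists_uniform_conformal_system[of V W m \<phi>] assms by blast
  then interpret conformal_bernoulli V W m \<phi> "\<lambda>i. deriv_norm (\<phi> i)" c L p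
    using assms(12) by (intro conformal_bernoulli.intro bernoulli.intro)
  have lyap: "lyapunov V \<phi> \<mu> = expectation log_deriv"
    unfolding lyapunov_def log_deriv_def[abs_def] ..
  define h where "h = - (\<Sum>i=1..m. p i * ln (p i))
      - 1 / real q * (\<Sum>i=1..s. ln (real (card (G i))) * (\<Sum>w\<in>G i. prod_list (map p w)))"
  have part: "partition_on (tuples {1..m} q) (G ` {1..s})" using assms(9) by (simp add: words_eq_tuples)
  have fin: "finite (tuples {1..m} q)" by (intro finite_tuples) simp
  have G_sub: "G i \<subseteq> tuples {1..m} q" if "i \<in> {1..s}" for i
    using part that unfolding partition_on_def by blast
  have G_fin: "finite (G i)" if "i \<in> {1..s}" for i using finite_subset[OF G_sub[OF that] fin] .
  have G_disj: "G i \<inter> G j = {}" if "i \<in> {1..s}" "j \<in> {1..s}" "i \<noteq> j" for i j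
  proof -
    have "G i \<noteq> G j" using that inj_onD[OF assms(10), of i j] by blast
    moreover have "disjoint (G ` {1..s})" using part by (rule partition_onD2)
    ultimately show ?thesis using that unfolding disjoint_def by (simp add: image_iff Bex_def)
  qed
  \<comment> \<open>The multiplicity of a word is the size of its cell; disjointness of the cells
    makes the description unique.\<close>
  define mult where "mult w = real (card (THE C. C \<in> G ` {1..s} \<and> w \<in> C))" for w
  have mult_eq: "mult w = real (card (G i))" if "i \<in> {1..s}" "w \<in> G i" for i w
  proof -
    have "(THE C. C \<in> G ` {1..s} \<and> w \<in> C) = G i"
      using that G_disj by (intro the_equality) blast+
    then show ?thesis by (simp add: mult_def)
  qed
  have cell: "\<exists>i\<in>{1..s}. w \<in> G i" if "w \<in> tuples {1..m} q" for w
    using part that unfolding partition_on_def by blast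
  have mult_pos: "0 < mult w" if w: "w \<in> tuples {1..m} q" for w
  proof -
    obtain i where i: "i \<in> {1..s}" "w \<in> G i" using cell[OF w] by blast
    then show ?thesis using mult_eq[OF i] G_fin[OF i(1)] by (auto simp: card_gt_0_iff)
  qed
  have overlap: "(\<Sum>w\<in>tuples {1..m} q. indicator (F w ` W) y / mult w) \<le> 1" for y
  proof (rule partition_overlap_le_1[OF fin part])
    show "F w ` W \<inter> F w' ` W = {}"
      if C: "C \<in> G ` {1..s}" "C' \<in> G ` {1..s}" "C \<noteq> C'" "w \<in> C" "w' \<in> C'" for C C' w w'
    proof -
      obtain i j where "i \<in> {1..s}" "C = G i" "j \<in> {1..s}" "C' = G j" using C(1,2) by blast
      then show ?thesis using C(3-5) assms(11) unfolding word_map_eq_foldr by metis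
    qed
  qed (use mult_eq in auto)
  have sum_mult: "(\<Sum>w\<in>tuples {1..m} q. prod_list (map p w) * ln (mult w))
      = (\<Sum>i=1..s. ln (real (card (G i))) * (\<Sum>w\<in>G i. prod_list (map p w)))"
  proof -
    have "tuples {1..m} q = (\<Union>i\<in>{1..s}. G i)" using part by (simp add: partition_on_def)
    then have "(\<Sum>w\<in>tuples {1..m} q. prod_list (map p w) * ln (mult w))
        = (\<Sum>i=1..s. \<Sum>w\<in>G i. prod_list (map p w) * ln (mult w))"
      using G_fin G_disj by (simp add: sum.UNION_disjoint)
    also have "\<dots> = (\<Sum>i=1..s. ln (real (card (G i))) * (\<Sum>w\<in>G i. prod_list (map p w)))"
      unfolding sum_distrib_left using mult_eq by (intro sum.cong) auto
    finally show ?thesis .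
  qed
  have "ereal (h / \<bar>expectation log_deriv\<bar>) \<le> HD (distr \<mu> borel (coding V \<phi>))"
    unfolding HD_def hausdorff_dim_def
  proof (intro INF_greatest)
    fix A t
    assume A: "A \<in> {A \<in> sets (distr \<mu> borel (coding V \<phi>)).
        space (distr \<mu> borel (coding V \<phi>)) - A \<in> null_sets (distr \<mu> borel (coding V \<phi>))}"
      and t: "t \<in> {t. 0 \<le> t \<and> hausdorff_measure t A = 0}"
    then have "AE x in distr \<mu> borel (coding V \<phi>). x \<in> A"
      by (intro AE_I'[of "UNIV - A"]) auto
    then have AE: "AE \<omega> in \<mu>. coding V \<phi> \<omega> \<in> A"
      by (rule AE_distrD[OF measurable_coding])
    \<comment> \<open>Otherwise \<open>t\<close> would satisfy the strict entropy inequality, and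
      \<open>A\<close> would have nonzero Hausdorff measure in dimension \<open>t\<close>.\<close>
    have "h \<le> - t * expectation log_deriv"
    proof (rule ccontr)
      assume "\<not> h \<le> - t * expectation log_deriv"
      then have "(\<Sum>i=1..m. p i * ln (p i))
          + 1 / real q * (\<Sum>w\<in>tuples {1..m} q. prod_list (map p w) * ln (mult w))
          < t * expectation log_deriv"
        unfolding h_def sum_mult by linarith
      then have "hausdorff_measure t A \<noteq> 0"
        using assms(4) t A
        by (intro hausdorff_measure_neq_0_of_overlap[OF _ mult_pos overlap _ _ _ AE]) auto
      then show False using t by simp
    qed
    also have "\<dots> \<le> t * \<bar>expectation log_deriv\<bar>"
      using t mult_left_mono[OF abs_ge_minus_self, of t "expectation log_deriv"] by simp
    \<comment> \<open>For exponent 0 the quotient is 0 by the convention on division, and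
      \<open>t \<ge> 0\<close> settles that case.\<close>
    finally have "h / \<bar>expectation log_deriv\<bar> \<le> t"
      using t by (cases "expectation log_deriv = 0") (simp_all add: field_simps)
    then show "ereal (h / \<bar>expectation log_deriv\<bar>) \<le> ereal t" by simp
  qed
  then show ?thesis by (simp add: lyap h_def self_conformal_measure_def)
qed

end
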